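(* Let $L$ be a label-forgetful random mapping from $\mathbb N$ to the non-empty subsets of $\mathbb N$ such that $|L([n])|<\infty$ almost surely for all $n\in\mathbb N$. Let $\{\Theta_k\}_{k\ge 0}$ be the de Finetti process (the forward process) and $\{A_k\}_{k\ge0}$ the block-counting process (the backward process) associated with $L$. Then these processes are moment dual: for all $k\in\mathbb N$, $n\in\mathbb N$ and $x\in[0,1]$, $$\mathbb E_x\big[\Theta_k^n\big]=\mathbb E_n\big[x^{A_k}\big],$$ where $\mathbb E_x$ is the expectation associated with $\{\Theta_k\}_k$ started at $x$ and $\mathbb E_n$ is the expectation associated with $\{A_k\}_k$ started at $n$.
   Context: $\mathbb N=\{1,2,\dots\}$ and $[n]=\{1,\dots,n\}$. A random mapping $L$ from $\mathbb N$ to the non-empty subsets of $\mathbb N$ is a sequence $\{L(i)\}_{i\in\mathbb N}$ (with arbitrary joint law) of random non-empty subsets of $\mathbb N$; for $S\subset\mathbb N$, $L(S)=\bigcup_{i\in S}L(i)$. $L$ is label-forgetful if $|L(S)|$ and $|L(S')|$ have the same distribution whenever $S,S'\subset\mathbb N$ satisfy $|S|=|S'|$. Label-forgetful mappings have the following property: if $\{X(i)\}_i$ is an exchangeable $\{0,1\}$-valued sequence independent of $L$, then $\{\inf_{j\in L(i)}X(j)\}_i$ is exchangeable. Forward (de Finetti) process: let $L_1,L_2,\dots$ be i.i.d. copies of $L$, independent of an exchangeable $\{0,1\}$-valued sequence $\{X_0(i)\}_{i}$. Define recursively $X_k(i)=\inf_{j\in L_k(i)}X_{k-1}(j)$ for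 $k\ge1$, $i\in\mathbb N$. Each $\{X_k(i)\}_i$ is exchangeable, and by de Finetti's theorem the limit $\Theta_k=\lim_{p\to\infty}\frac1p\sum_{i=1}^pX_k(i)$ exists almost surely; conditionally on $\Theta_k$ the $X_k(i)$ are i.i.d. Bernoulli($\Theta_k$). The process $\{\Theta_k\}_k$ is a $[0,1]$-valued Markov chain. "Started at $x$" means $\Theta_0=x$ almost surely, i.e. the $X_0(i)$ are i.i.d. Bernoulli($x$). Backward (block-counting) process: $\{A_k\}_{k\ge0}$ is the $\mathbb N$-valued Markov chain with transitions $\mathbb P(A_1=m\mid A_0=n)=\mathbb P(|L([n])|=m)$, $n,m\in\mathbb N$. *)

theory Defs
  imports "HOL-Probability.Probability"
begin

text \<open>
  The label set is the positive naturals \<open>{1..}\<close>. Families indexed by labels or by positive times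
  are functions on \<open>nat\<close> that are only ever inspected on \<open>{1..}\<close>; their values at index 0 are
  irrelevant.
\<close>

definition nonempty_subsets :: "nat set set" where
  "nonempty_subsets = {A. A \<subseteq> {1..} \<and> A \<noteq> {}}"

text \<open>The \<open>\<sigma>\<close>-algebra inherited from the product space \<open>{0, 1}\<close> to the power \<open>{1..}\<close>, that is,
  the one generated by the events that a given label belongs to the random set.\<close>

definition subset_space :: "nat set measure" where
  "subset_space = sigma nonempty_subsets ((\<lambda>j. {A \<in> nonempty_subsets. j \<in> A}) ` {1..})"

definition mapping_space :: "(nat \<Rightarrow> nat set) measure" where
  "mapping_space = (\<Pi>\<^sub>M i\<in>{1..}. subset_space)"

definition random_mapping :: "'a measure \<Rightarrow> (nat \<Rightarrow> 'a \<Rightarrow> nat set) \<Rightarrow> bool" where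
  "random_mapping M L \<longleftrightarrow> prob_space M \<and> (\<forall>i\<in>{1..}. L i \<in> M \<rightarrow>\<^sub>M subset_space)"

definition mapping_sequence :: "(nat \<Rightarrow> 'a \<Rightarrow> nat set) \<Rightarrow> 'a \<Rightarrow> nat \<Rightarrow> nat set" where
  "mapping_sequence L \<omega> = (\<lambda>i\<in>{1..}. L i \<omega>)"

definition mapping_image :: "(nat \<Rightarrow> 'a \<Rightarrow> nat set) \<Rightarrow> nat set \<Rightarrow> 'a \<Rightarrow> nat set" where
  "mapping_image L S \<omega> = (\<Union>i\<in>S. L i \<omega>)"

text \<open>Cardinality with value \<open>\<infinity>\<close> on infinite sets (where \<open>card\<close> returns 0).\<close>

definition ecard :: "nat set \<Rightarrow> enat" where
  "ecard A = (if finite A then enat (card A) else \<infinity>)"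

definition label_forgetful :: "'a measure \<Rightarrow> (nat \<Rightarrow> 'a \<Rightarrow> nat set) \<Rightarrow> bool" where
  "label_forgetful M L \<longleftrightarrow>
     (\<forall>S S'. S \<subseteq> {1..} \<and> S' \<subseteq> {1..} \<and> ecard S = ecard S' \<longrightarrow>
        distr M (count_space UNIV) (\<lambda>\<omega>. ecard (mapping_image L S \<omega>)) =
        distr M (count_space UNIV) (\<lambda>\<omega>. ecard (mapping_image L S' \<omega>)))"

definition bit_sequence_space :: "(nat \<Rightarrow> nat) measure" where
  "bit_sequence_space = (\<Pi>\<^sub>M i\<in>{1..}. count_space {0, 1})"

definition bit_sequence :: "(nat \<Rightarrow> 'b \<Rightarrow> nat) \<Rightarrow> 'b \<Rightarrow> nat \<Rightarrow> nat" where
  "bit_sequence X \<omega> = (\<lambda>i\<in>{1..}. X i \<omega>)"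

definition exchangeable_bits :: "'b measure \<Rightarrow> (nat \<Rightarrow> 'b \<Rightarrow> nat) \<Rightarrow> bool" where
  "exchangeable_bits P X \<longleftrightarrow>
     (\<forall>i\<in>{1..}. X i \<in> P \<rightarrow>\<^sub>M (count_space {0, 1})) \<and>
     (\<forall>\<pi> F. finite F \<and> F \<subseteq> {1..} \<and> \<pi> permutes F \<longrightarrow>
        distr P bit_sequence_space (bit_sequence (\<lambda>i. X (\<pi> i))) =
        distr P bit_sequence_space (bit_sequence X))"

definition iid_copies ::
  "'a measure \<Rightarrow> (nat \<Rightarrow> 'a \<Rightarrow> nat set) \<Rightarrow> 'b measure \<Rightarrow> (nat \<Rightarrow> nat \<Rightarrow> 'b \<Rightarrow> nat set) \<Rightarrow> bool" where
  "iid_copies M L P Ls \<longleftrightarrow>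
     (\<forall>k\<in>{1..}. random_mapping P (Ls k) \<and>
        distr P mapping_space (mapping_sequence (Ls k)) =
        distr M mapping_space (mapping_sequence L)) \<and>
     prob_space.indep_vars P (\<lambda>_. mapping_space) (\<lambda>k. mapping_sequence (Ls k)) {1..}"

text \<open>The initial sequence \<open>X0\<close> is independent of the whole family \<open>Ls 1, Ls 2, \<dots>\<close>. The two
  objects have values of different types, hence the formulation through the generated
  \<open>\<sigma>\<close>-algebras.\<close>

definition forward_input ::
  "'a measure \<Rightarrow> (nat \<Rightarrow> 'a \<Rightarrow> nat set) \<Rightarrow> 'b measure \<Rightarrow> (nat \<Rightarrow> nat \<Rightarrow> 'b \<Rightarrow> nat set) \<Rightarrow>
   (nat \<Rightarrow> 'b \<Rightarrow> nat) \<Rightarrow> bool" where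
  "forward_input M L P Ls X0 \<longleftrightarrow>
     prob_space P \<and> iid_copies M L P Ls \<and> exchangeable_bits P X0 \<and>
     prob_space.indep_set P
       (sets (vimage_algebra (space P) (bit_sequence X0) bit_sequence_space))
       (sets (vimage_algebra (space P) (\<lambda>\<omega>. \<lambda>k\<in>{1..}. mapping_sequence (Ls k) \<omega>)
          (\<Pi>\<^sub>M k\<in>{1..}. mapping_space)))"

primrec forward_bits ::
  "(nat \<Rightarrow> nat \<Rightarrow> 'b \<Rightarrow> nat set) \<Rightarrow> (nat \<Rightarrow> 'b \<Rightarrow> nat) \<Rightarrow> nat \<Rightarrow> nat \<Rightarrow> 'b \<Rightarrow> nat" where
  "forward_bits Ls X0 0 = X0"
| "forward_bits Ls X0 (Suc k) = (\<lambda>i \<omega>. INF j\<in>Ls (Suc k) i \<omega>. forward_bits Ls X0 k j \<omega>)"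

text \<open>By exchangeability the limit exists almost surely; \<open>lim\<close> has an arbitrary value on the
  exceptional null set.\<close>

definition de_finetti_process ::
  "(nat \<Rightarrow> nat \<Rightarrow> 'b \<Rightarrow> nat set) \<Rightarrow> (nat \<Rightarrow> 'b \<Rightarrow> nat) \<Rightarrow> nat \<Rightarrow> 'b \<Rightarrow> real" where
  "de_finetti_process Ls X0 k \<omega> =
     lim (\<lambda>p. 1 / real p * (\<Sum>i=1..p. real (forward_bits Ls X0 k i \<omega>)))"

definition block_transition :: "'a measure \<Rightarrow> (nat \<Rightarrow> 'a \<Rightarrow> nat set) \<Rightarrow> nat \<Rightarrow> nat \<Rightarrow> real" where
  "block_transition M L n m = \<P>(\<omega> in M. ecard (mapping_image L {1..n} \<omega>) = enat m)"

text \<open>A (time-homogeneous) Markov chain on \<open>{1..}\<close> with these transition probabilities: the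
  Markov property is required given every history \<open>a 0, \<dots>, a k\<close> of positive probability.\<close>

definition block_counting_process ::
  "'a measure \<Rightarrow> (nat \<Rightarrow> 'a \<Rightarrow> nat set) \<Rightarrow> 'c measure \<Rightarrow> (nat \<Rightarrow> 'c \<Rightarrow> nat) \<Rightarrow> bool" where
  "block_counting_process M L Q A \<longleftrightarrow>
     prob_space Q \<and>
     (\<forall>k. A k \<in> Q \<rightarrow>\<^sub>M (count_space {1..})) \<and>
     (\<forall>k a. \<P>(\<omega> in Q. \<forall>i\<le>k. A i \<omega> = a i) > 0 \<longrightarrow>
        (\<forall>m\<in>{1..}. \<P>(\<omega> in Q. A (Suc k) \<omega> = m \<bar> \<forall>i\<le>k. A i \<omega> = a i) =
                     block_transition M L (a k) m))"

end

theory Submission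
  imports Defs
begin

text \<open>
  Both sides equal \<open>u k n\<close>, where \<open>u 0 n = x ^ n\<close> and \<open>u (k + 1) n\<close> is the sum over \<open>m\<close> of
  \<open>\<P>(|L([n])| = m) * u k m\<close>. For the backward process this is the iterated one-step Markov
  property. For the forward process, \<open>X\<^sub>k\<^sub>+\<^sub>1 = 1\<close> on a finite set \<open>S\<close> iff \<open>X\<^sub>k = 1\<close> on
  \<open>L\<^sub>k\<^sub>+\<^sub>1(S)\<close>; splitting over the values of this almost surely finite set shows by induction
  that \<open>\<P>(X\<^sub>k = 1 on S) = u k |S|\<close>.

  De Finetti's theorem is not needed to pass to the limit \<open>\<Theta>\<^sub>k\<close>. If the probability that bits
  equal 1 on \<open>S\<close> depends on \<open>|S|\<close> only, the averages of \<open>p\<close> and of \<open>q \<ge> p\<close> bits are at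
  \<open>L\<^sup>2\<close> distance at most \<open>1 / \<surd>p\<close>, so they converge almost surely along fourth powers and hence
  along all \<open>p\<close>. If \<open>N\<close> of the first \<open>p\<close> bits are 1, then \<open>(N choose n) / (p choose n)\<close> is the
  proportion of \<open>n\<close>-subsets of \<open>[p]\<close> on which all bits are 1; its expectation is the \<open>n\<close>-th such
  probability, and it converges to the \<open>n\<close>-th power of the limit.
\<close>

subsection \<open>Averages of bits\<close>

text \<open>Partial sums of nonnegative terms are monotone. For \<open>r^4 \<le> p < (r+1)^4\<close>
  the average at \<open>p\<close> therefore lies between those at \<open>r^4\<close> and
  \<open>(r+1)^4\<close>, up to the factors \<open>(r/(r+1))^4\<close> and
  \<open>((r+1)/r)^4\<close>, both of which tend to 1.\<close>

lemma LIMSEQ_averages_from_fourth_powers: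
  fixes y :: "nat \<Rightarrow> real"
  assumes nonneg: "\<And>i. i \<in> {1..} \<Longrightarrow> 0 \<le> y i"
    and lim: "(\<lambda>k. (\<Sum>i=1..k^4. y i) / real (k^4)) \<longlonglongrightarrow> l"
  shows "(\<lambda>p. (\<Sum>i=1..p. y i) / real p) \<longlonglongrightarrow> l"
proof -
  define N where "N p = (\<Sum>i=1..p. y i)" for p
  define r where "r p = nat \<lfloor>root 4 (real p)\<rfloor>" for p :: nat
  have N_mono: "N p \<le> N q" if "p \<le> q" for p q
    unfolding N_def using that nonneg by (intro sum_mono2) auto
  have N_nonneg: "0 \<le> N p" for p
    unfolding N_def using nonneg by (intro sum_nonneg) auto
  have r_le: "r p ^ 4 \<le> p" for p
  proof -
    have "real (r p) \<le> root 4 (real p)"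
      unfolding r_def by (simp add: of_nat_nat)
    then have "real (r p) ^ 4 \<le> root 4 (real p) ^ 4"
      by (rule power_mono) simp
    then show ?thesis
      by (simp flip: of_nat_power)
  qed
  have r_gt: "p < Suc (r p) ^ 4" for p
  proof -
    have "root 4 (real p) < real (Suc (r p))"
      unfolding r_def by simp linarith
    then have "root 4 (real p) ^ 4 < real (Suc (r p)) ^ 4"
      by (intro power_strict_mono) auto
    then have "real p < real (Suc (r p) ^ 4)"
      by (simp del: of_nat_Suc)
    then show ?thesis
      using of_nat_less_iff by blast
  qed
  have r_top: "filterlim r at_top sequentially"
    unfolding filterlim_at_top
  proof
    fix Z
    have "Z \<le> r p" if "Z ^ 4 \<le> p" for p
    proof -
      have "Z ^ 4 < Suc (r p) ^ 4" using that r_gt[of p] by linarith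
      then have "Z < Suc (r p)" by (rule power_less_imp_less_base) simp
      then show ?thesis by simp
    qed
    then show "eventually (\<lambda>p. Z \<le> r p) sequentially"
      by (auto simp: eventually_sequentially)
  qed
  have ratio: "(\<lambda>k. (real k / real (Suc k)) ^ 4) \<longlonglongrightarrow> 1"
    using tendsto_power[OF LIMSEQ_n_over_Suc_n, of 4] by simp
  have ratio': "(\<lambda>k. (real (Suc k) / real k) ^ 4) \<longlonglongrightarrow> 1"
    using tendsto_power[OF LIMSEQ_Suc_n_over_n, of 4] by simp
  have lim': "(\<lambda>k. N (k^4) / real (k^4)) \<longlonglongrightarrow> l"
    using lim unfolding N_def .
  have "(\<lambda>k. N (k^4) / real (k^4) * (real k / real (Suc k)) ^ 4) \<longlonglongrightarrow> l"
    using tendsto_mult[OF lim' ratio] by simp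
  then have lower: "(\<lambda>p. N (r p^4) / real (r p^4) * (real (r p) / real (Suc (r p))) ^ 4) \<longlonglongrightarrow> l"
    by (rule filterlim_compose[OF _ r_top])
  have "(\<lambda>k. N (Suc k^4) / real (Suc k^4) * (real (Suc k) / real k) ^ 4) \<longlonglongrightarrow> l"
    using tendsto_mult[OF LIMSEQ_Suc[OF lim'] ratio'] by simp
  then have upper: "(\<lambda>p. N (Suc (r p)^4) / real (Suc (r p)^4) * (real (Suc (r p)) / real (r p)) ^ 4) \<longlonglongrightarrow> l"
    by (rule filterlim_compose[OF _ r_top])
  \<comment> \<open>The sandwich inequalities divide by \<open>r p\<close>, so they are claimed only
    where it is nonzero.\<close>
  have pos: "eventually (\<lambda>p. 1 \<le> r p) sequentially"
    using r_top unfolding filterlim_at_top by blast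
  have "(\<lambda>p. N p / real p) \<longlonglongrightarrow> l"
  proof (rule tendsto_sandwich[OF _ _ lower upper])
    show "eventually (\<lambda>p. N (r p^4) / real (r p^4) * (real (r p) / real (Suc (r p))) ^ 4 \<le> N p / real p) sequentially"
      using pos
    proof eventually_elim
      case (elim p)
      have p: "0 < p" using elim r_le[of p] by (metis le_trans nat_zero_less_power_iff not_one_le_zero neq0_conv le_zero_eq)
      have "N (r p^4) / real (r p^4) * (real (r p) / real (Suc (r p))) ^ 4 = N (r p^4) / real (Suc (r p) ^ 4)"
        using elim by (simp add: power_divide del: of_nat_Suc)
      also have "\<dots> \<le> N p / real p"
        using p r_gt[of p] by (intro frac_le N_mono r_le N_nonneg) (auto simp del: of_nat_Suc of_nat_power)
      finally show ?case .
    qed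
    show "eventually (\<lambda>p. N p / real p \<le> N (Suc (r p)^4) / real (Suc (r p)^4) * (real (Suc (r p)) / real (r p)) ^ 4) sequentially"
      using pos
    proof eventually_elim
      case (elim p)
      have "N p / real p \<le> N (Suc (r p)^4) / real (r p ^ 4)"
        using r_le[of p] elim N_mono[OF less_imp_le[OF r_gt[of p]]]
        by (intro frac_le N_nonneg) (auto simp del: of_nat_Suc of_nat_power)
      also have "\<dots> = N (Suc (r p)^4) / real (Suc (r p)^4) * (real (Suc (r p)) / real (r p)) ^ 4"
        using elim by (simp add: power_divide del: of_nat_Suc)
      finally show "N p / real p \<le> N (Suc (r p)^4) / real (Suc (r p)^4) * (real (Suc (r p)) / real (r p)) ^ 4" .
    qed
  qed
  then show ?thesis
    unfolding N_def .
qed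

text \<open>Writing both binomials as falling factorials over \<open>n!\<close> turns the ratio into
  the product over \<open>i < n\<close> of \<open>(N p - i) / (p - i)\<close>, and each factor tends
  to \<open>\<theta>\<close>. Subtraction is done in the reals, so the identity also covers
  \<open>N p < n\<close>, where a factor vanishes.\<close>

lemma LIMSEQ_binomial_ratio:
  fixes N :: "nat \<Rightarrow> nat" and \<theta> :: real
  assumes "(\<lambda>p. real (N p) / real p) \<longlonglongrightarrow> \<theta>"
  shows "(\<lambda>p. real (N p choose n) / real (p choose n)) \<longlonglongrightarrow> \<theta> ^ n"
proof -
  have "(\<lambda>p. (real (N p) - real i) / (real p - real i)) \<longlonglongrightarrow> \<theta>" for i
  proof -
    have inv: "(\<lambda>p. real i / real p) \<longlonglongrightarrow> 0"
      by (rule lim_const_over_n)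
    have "(\<lambda>p. (real (N p) / real p - real i / real p) / (1 - real i / real p)) \<longlonglongrightarrow> (\<theta> - 0) / (1 - 0)"
      by (intro tendsto_divide tendsto_diff assms inv tendsto_const) simp
    then have "(\<lambda>p. (real (N p) / real p - real i / real p) / (1 - real i / real p)) \<longlonglongrightarrow> \<theta>"
      by simp
    moreover have "eventually (\<lambda>p. (real (N p) / real p - real i / real p) / (1 - real i / real p)
        = (real (N p) - real i) / (real p - real i)) sequentially"
      using eventually_gt_at_top[of 0]
      by eventually_elim (simp add: divide_simps)
    ultimately show ?thesis
      by (rule Lim_transform_eventually)
  qed
  then have "(\<lambda>p. \<Prod>i = 0..<n. (real (N p) - real i) / (real p - real i)) \<longlonglongrightarrow> (\<Prod>i = 0..<n. \<theta>)"
    by (intro tendsto_prod)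
  then show ?thesis
    by (simp add: binomial_gbinomial gbinomial_prod_rev prod_dividef)
qed

section \<open>Almost sure summability and countable partitions\<close>

context prob_space
begin

text \<open>Sum and integral of nonnegative functions commute, so the sum of the absolute values has
  finite expectation and is finite almost surely.\<close>

lemma AE_summable_abs:
  fixes f :: "nat \<Rightarrow> 'a \<Rightarrow> real"
  assumes int: "\<And>k. integrable M (f k)"
    and sum: "summable (\<lambda>k. expectation (\<lambda>\<omega>. \<bar>f k \<omega>\<bar>))"
  shows "AE \<omega> in M. summable (\<lambda>k. \<bar>f k \<omega>\<bar>)"
proof -
  have [measurable]: "f k \<in> borel_measurable M" for k
    using int by auto
  have "(\<integral>\<^sup>+\<omega>. (\<Sum>k. ennreal \<bar>f k \<omega>\<bar>) \<partial>M) = (\<Sum>k. \<integral>\<^sup>+\<omega>. ennreal \<bar>f k \<omega>\<bar> \<partial>M)"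
    by (rule nn_integral_suminf) simp
  also have "\<dots> = (\<Sum>k. ennreal (expectation (\<lambda>\<omega>. \<bar>f k \<omega>\<bar>)))"
    using int by (subst nn_integral_eq_integral) auto
  also have "\<dots> = ennreal (\<Sum>k. expectation (\<lambda>\<omega>. \<bar>f k \<omega>\<bar>))"
    using sum by (intro suminf_ennreal2) auto
  finally have "(\<integral>\<^sup>+\<omega>. (\<Sum>k. ennreal \<bar>f k \<omega>\<bar>) \<partial>M) \<noteq> \<infinity>"
    by simp
  then have "AE \<omega> in M. (\<Sum>k. ennreal \<bar>f k \<omega>\<bar>) \<noteq> \<infinity>"
    by (intro nn_integral_PInf_AE) simp_all
  then show ?thesis
    by eventually_elim (auto intro: summable_suminf_not_top)
qed

text \<open>By disjointness the partial sum \<open>g m\<close> is \<open>f\<close> on the first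
  \<open>m\<close> events and 0 elsewhere, so dominated convergence with bound
  \<open>\<bar>f\<bar>\<close> applies. This serves every splitting over a countably-valued quantity
  below: image sets, their cardinalities, and histories of the chain.\<close>

lemma sums_expectation_partition:
  fixes f :: "'a \<Rightarrow> real"
  assumes f: "integrable M f" and E: "\<And>n. E n \<in> events" and disj: "disjoint_family E"
    and cover: "AE \<omega> in M. \<exists>n. \<omega> \<in> E n"
  shows "(\<lambda>n. expectation (\<lambda>\<omega>. f \<omega> * indicator (E n) \<omega>)) sums expectation f"
proof -
  define g where "g m \<omega> = (\<Sum>n<m. f \<omega> * indicator (E n) \<omega>)" for m \<omega>
  have g: "g m \<omega> = (if \<exists>n<m. \<omega> \<in> E n then f \<omega> else 0)" for m \<omega>
  proof (cases "\<exists>n<m. \<omega> \<in> E n")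
    case True
    then obtain n where n: "n < m" "\<omega> \<in> E n"
      by blast
    have "f \<omega> * indicator (E n') \<omega> = (if n' = n then f \<omega> else 0)" for n'
      using n(2) disj by (auto simp: indicator_def disjoint_family_on_def)
    then have "g m \<omega> = f \<omega>"
      using n(1) by (simp add: g_def)
    with True show ?thesis
      by simp
  qed (auto simp: g_def)
  have int: "integrable M (\<lambda>\<omega>. f \<omega> * indicator (E n) \<omega>)" for n
    using integrable_mult_indicator[OF E f, of n] by (simp add: mult.commute)
  have "(\<lambda>m. expectation (g m)) \<longlonglongrightarrow> expectation f"
  proof (rule integral_dominated_convergence[where w = "\<lambda>\<omega>. \<bar>f \<omega>\<bar>"])
    show "AE \<omega> in M. (\<lambda>m. g m \<omega>) \<longlonglongrightarrow> f \<omega>"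
      using cover
    proof eventually_elim
      case (elim \<omega>)
      then obtain n where n: "\<omega> \<in> E n"
        by blast
      have "\<forall>\<^sub>F m in sequentially. g m \<omega> = f \<omega>"
        using eventually_gt_at_top[of n] by eventually_elim (use n in \<open>auto simp: g\<close>)
      then show ?case
        by (rule tendsto_eventually)
    qed
    show "g m \<in> borel_measurable M" for m
      unfolding g_def using int by (intro borel_measurable_sum borel_measurable_integrable)
    show "AE \<omega> in M. norm (g m \<omega>) \<le> \<bar>f \<omega>\<bar>" for m
      by (auto simp: g)
  qed (use f in auto)
  moreover have "expectation (g m) = (\<Sum>n<m. expectation (\<lambda>\<omega>. f \<omega> * indicator (E n) \<omega>))" for m
    unfolding g_def using int by (rule Bochner_Integration.integral_sum)
  ultimately show ?thesis
    by (simp add: sums_def)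
qed

lemma sums_prob_partition:
  assumes D: "D \<in> events" and E: "\<And>n. E n \<in> events" "disjoint_family E"
    and cover: "AE \<omega> in M. \<exists>n. \<omega> \<in> E n"
  shows "(\<lambda>n. prob (D \<inter> E n)) sums prob D"
proof -
  have "integrable M (indicator D :: 'a \<Rightarrow> real)"
    using D by (simp add: less_top[symmetric])
  from sums_expectation_partition[OF this E cover] show ?thesis
    using D E(1) by (simp add: sets.Int_space_eq2 flip: indicator_inter_arith)
qed

section \<open>Moments of bits whose all-one probabilities depend on cardinality only\<close>

text \<open>By inclusion-exclusion \<open>m\<close> fixes the joint law of any finitely many of the
  bits. This form of exchangeability is the one that the forward recursion reproduces directly, with
  \<open>m\<close> being the moment sequence of the limiting average.\<close>

context
  fixes X :: "nat \<Rightarrow> 'a \<Rightarrow> nat" and m :: "nat \<Rightarrow> real"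
  assumes X_measurable: "\<And>i. i \<in> {1..} \<Longrightarrow> X i \<in> M \<rightarrow>\<^sub>M count_space {0, 1}"
    and prob_all_one: "\<And>S. finite S \<Longrightarrow> S \<subseteq> {1..} \<Longrightarrow>
      prob {\<omega> \<in> space M. \<forall>i\<in>S. X i \<omega> = 1} = m (card S)"
begin

lemma bit_measurable: "i \<in> {1..} \<Longrightarrow> X i \<in> M \<rightarrow>\<^sub>M count_space UNIV"
  using X_measurable[of i] by (rule measurable_compose) (auto simp only: measurable_count_space_eq1 space_count_space)

lemma bit_cases: "i \<in> {1..} \<Longrightarrow> \<omega> \<in> space M \<Longrightarrow> X i \<omega> = 0 \<or> X i \<omega> = 1"
  using measurable_space[OF X_measurable[of i]] by auto

lemma bit_real_measurable: "i \<in> {1..} \<Longrightarrow> (\<lambda>\<omega>. real (X i \<omega>)) \<in> borel_measurable M"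
  using measurable_compose[OF bit_measurable[of i], of real borel] by simp

lemma averages_measurable:
  "(\<lambda>\<omega>. (\<Sum>i=1..p. real (X i \<omega>)) / real p) \<in> borel_measurable M"
  by (intro borel_measurable_divide borel_measurable_sum bit_real_measurable) auto

lemma lim_averages_measurable:
  "(\<lambda>\<omega>. lim (\<lambda>p. 1 / real p * (\<Sum>i=1..p. real (X i \<omega>)))) \<in> borel_measurable M"
  using borel_measurable_lim_metric[OF averages_measurable] by simp

lemma averages_bounds:
  assumes "\<omega> \<in> space M"
  shows "0 \<le> (\<Sum>i=1..p. real (X i \<omega>)) / real p" "(\<Sum>i=1..p. real (X i \<omega>)) / real p \<le> 1"
proof -
  have "(\<Sum>i=1..p. real (X i \<omega>)) \<le> (\<Sum>i=1..p. 1)"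
    using bit_cases[OF _ assms] by (intro sum_mono) fastforce
  then show "(\<Sum>i=1..p. real (X i \<omega>)) / real p \<le> 1"
    by (cases "p = 0") (simp_all add: divide_le_eq_1)
qed (simp add: sum_nonneg)

text \<open>A product of bits is the indicator of the event that all of them are 1.\<close>

lemma expectation_prod_bits:
  assumes "finite S" "S \<subseteq> {1..}"
  shows "expectation (\<lambda>\<omega>. \<Prod>i\<in>S. real (X i \<omega>)) = m (card S)"
proof -
  have "(\<Prod>i\<in>S. real (X i \<omega>)) = indicator {\<omega>\<in>space M. \<forall>i\<in>S. X i \<omega> = 1} \<omega>" if "\<omega> \<in> space M" for \<omega>
  proof (cases "\<forall>i\<in>S. X i \<omega> = 1")
    case False
    then obtain i where i: "i \<in> S" "X i \<omega> \<noteq> 1"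
      by blast
    then have "X i \<omega> = 0"
      using bit_cases[of i] that assms(2) by blast
    then have "(\<Prod>i\<in>S. real (X i \<omega>)) = 0"
      using assms(1) i by (intro prod_zero) auto
    with False show ?thesis
      by simp
  qed (use that in simp)
  then have "expectation (\<lambda>\<omega>. \<Prod>i\<in>S. real (X i \<omega>))
      = expectation (indicator {\<omega>\<in>space M. \<forall>i\<in>S. X i \<omega> = 1})"
    by (intro Bochner_Integration.integral_cong) auto
  also have "\<dots> = prob {\<omega>\<in>space M. \<forall>i\<in>S. X i \<omega> = 1}"
    by (simp add: Int_def conj_commute)
  finally show ?thesis
    using prob_all_one[OF assms] by simp
qed

lemma integrable_prod_bits:
  assumes "finite S" "S \<subseteq> {1..}"
  shows "integrable M (\<lambda>\<omega>. \<Prod>i\<in>S. real (X i \<omega>))"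
proof (rule integrable_const_bound[where B = 1])
  show "(\<lambda>\<omega>. \<Prod>i\<in>S. real (X i \<omega>)) \<in> borel_measurable M"
    using assms by (intro borel_measurable_prod bit_real_measurable) auto
  have "\<bar>\<Prod>i\<in>S. real (X i \<omega>)\<bar> \<le> 1" if "\<omega> \<in> space M" for \<omega>
    unfolding abs_prod
    using assms bit_cases[OF _ that] by (intro prod_le_1) fastforce
  then show "AE \<omega> in M. norm (\<Prod>i\<in>S. real (X i \<omega>)) \<le> 1"
    by auto
qed

text \<open>A bit is its own square, so the diagonal case has a single factor and gives
  \<open>m 1\<close>. Stating the value as \<open>m 2\<close> plus a diagonal correction lets double
  sums split into two pieces.\<close>

lemma expectation_two_bits:
  assumes "i \<in> {1..}" "j \<in> {1..}"
  shows "integrable M (\<lambda>\<omega>. real (X i \<omega>) * real (X j \<omega>))"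
    and "expectation (\<lambda>\<omega>. real (X i \<omega>) * real (X j \<omega>)) = m 2 + (if i = j then m 1 - m 2 else 0)"
proof -
  have eq: "real (X i \<omega>) * real (X j \<omega>) = (\<Prod>h\<in>{i,j}. real (X h \<omega>))" if "\<omega> \<in> space M" for \<omega>
    using bit_cases[OF assms(1) that] by (cases "i = j") auto
  show "integrable M (\<lambda>\<omega>. real (X i \<omega>) * real (X j \<omega>))"
    using assms
    by (intro iffD2[OF Bochner_Integration.integrable_cong[OF refl eq]] integrable_prod_bits) auto
  have "expectation (\<lambda>\<omega>. real (X i \<omega>) * real (X j \<omega>)) = expectation (\<lambda>\<omega>. \<Prod>h\<in>{i,j}. real (X h \<omega>))"
    by (rule Bochner_Integration.integral_cong[OF refl eq])
  also have "\<dots> = m (card {i,j})"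
    using assms by (intro expectation_prod_bits) auto
  finally have "expectation (\<lambda>\<omega>. real (X i \<omega>) * real (X j \<omega>)) = m (card {i,j})" .
  moreover have "card {i,j} = (if i = j then 1 else 2)"
    by simp
  ultimately have "expectation (\<lambda>\<omega>. real (X i \<omega>) * real (X j \<omega>)) = m (if i = j then 1 else 2)"
    by (simp only:)
  then show "expectation (\<lambda>\<omega>. real (X i \<omega>) * real (X j \<omega>)) = m 2 + (if i = j then m 1 - m 2 else 0)"
    by (rule trans) simp
qed

text \<open>Expanding the square, the common value \<open>m 2\<close> contributes the square of the
  total weight, and the diagonal excess \<open>m 1 - m 2\<close> contributes the sum of squared
  weights. Weights of total 0 leave only the second term.\<close>

lemma expectation_linear_combination_square:
  assumes "finite I" "I \<subseteq> {1..}"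
  shows "integrable M (\<lambda>\<omega>. (\<Sum>i\<in>I. w i * real (X i \<omega>))\<^sup>2)"
    and "expectation (\<lambda>\<omega>. (\<Sum>i\<in>I. w i * real (X i \<omega>))\<^sup>2)
      = m 2 * (\<Sum>i\<in>I. w i)\<^sup>2 + (m 1 - m 2) * (\<Sum>i\<in>I. (w i)\<^sup>2)"
proof -
  have eq: "(\<Sum>i\<in>I. w i * real (X i \<omega>))\<^sup>2 = (\<Sum>i\<in>I. \<Sum>j\<in>I. w i * w j * (real (X i \<omega>) * real (X j \<omega>)))" for \<omega>
    unfolding power2_eq_square sum_product by (intro sum.cong refl) (simp only: mult_ac)
  have int: "integrable M (\<lambda>\<omega>. w i * w j * (real (X i \<omega>) * real (X j \<omega>)))"
    if "i \<in> I" "j \<in> I" for i j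
    using that assms by (intro integrable_mult_right expectation_two_bits(1)) auto
  show "integrable M (\<lambda>\<omega>. (\<Sum>i\<in>I. w i * real (X i \<omega>))\<^sup>2)"
    unfolding eq by (intro Bochner_Integration.integrable_sum int)
  have "expectation (\<lambda>\<omega>. (\<Sum>i\<in>I. w i * real (X i \<omega>))\<^sup>2)
      = (\<Sum>i\<in>I. expectation (\<lambda>\<omega>. \<Sum>j\<in>I. w i * w j * (real (X i \<omega>) * real (X j \<omega>))))"
    unfolding eq by (intro Bochner_Integration.integral_sum Bochner_Integration.integrable_sum int)
  also have "\<dots> = (\<Sum>i\<in>I. \<Sum>j\<in>I. w i * w j * expectation (\<lambda>\<omega>. real (X i \<omega>) * real (X j \<omega>)))"
    using int by (simp only: Bochner_Integration.integral_sum integral_mult_right_zero cong: sum.cong)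
  also have "\<dots> = (\<Sum>i\<in>I. \<Sum>j\<in>I. w i * w j * m 2 + (if i = j then w i * w j * (m 1 - m 2) else 0))"
  proof (intro sum.cong refl)
    fix i j assume "i \<in> I" "j \<in> I"
    then have "expectation (\<lambda>\<omega>. real (X i \<omega>) * real (X j \<omega>)) = m 2 + (if i = j then m 1 - m 2 else 0)"
      using assms by (intro expectation_two_bits(2)) auto
    then show "w i * w j * expectation (\<lambda>\<omega>. real (X i \<omega>) * real (X j \<omega>))
        = w i * w j * m 2 + (if i = j then w i * w j * (m 1 - m 2) else 0)"
      by (simp only: distrib_left if_distrib[of "\<lambda>z. w i * w j * z"] mult_zero_right)
  qed
  also have "\<dots> = m 2 * (\<Sum>i\<in>I. w i)\<^sup>2 + (m 1 - m 2) * (\<Sum>i\<in>I. (w i)\<^sup>2)"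
    using assms(1)
    by (simp only: sum.distrib power2_eq_square sum_product sum_distrib_right[symmetric])
      (simp add: sum_distrib_left mult_ac)
  finally show "expectation (\<lambda>\<omega>. (\<Sum>i\<in>I. w i * real (X i \<omega>))\<^sup>2)
      = m 2 * (\<Sum>i\<in>I. w i)\<^sup>2 + (m 1 - m 2) * (\<Sum>i\<in>I. (w i)\<^sup>2)" .
qed

text \<open>The difference is a linear combination with weights \<open>1/p - 1/q\<close> up to
  \<open>p\<close> and \<open>-1/q\<close> from there to \<open>q\<close>. They sum to 0 and their
  squares sum to \<open>1/p - 1/q\<close>, while \<open>m 1 - m 2 \<le> 1\<close>.\<close>

lemma averages_difference_square:
  assumes "1 \<le> p" "p \<le> q"
  defines "D \<equiv> \<lambda>\<omega>. (\<Sum>i=1..p. real (X i \<omega>)) / real p - (\<Sum>i=1..q. real (X i \<omega>)) / real q"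
  shows "integrable M (\<lambda>\<omega>. (D \<omega>)\<^sup>2)" "expectation (\<lambda>\<omega>. (D \<omega>)\<^sup>2) \<le> 1 / real p"
proof -
  define w :: "nat \<Rightarrow> real" where "w i = (if i \<le> p then 1 / real p else 0) - 1 / real q" for i
  have restrict: "(\<Sum>i=1..q. if i \<le> p then h i else 0) = (\<Sum>i=1..p. h i)" for h :: "nat \<Rightarrow> real"
  proof -
    have "{i \<in> {1..q}. i \<le> p} = {1..p}" using assms(1,2) by auto
    then show ?thesis
      using sum.inter_filter[of "{1..q}" h "\<lambda>i. i \<le> p"] by (simp only: finite_atLeastAtMost)
  qed
  have D: "D \<omega> = (\<Sum>i=1..q. w i * real (X i \<omega>))" for \<omega>
  proof -
    have "(\<Sum>i=1..q. w i * real (X i \<omega>))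
        = (\<Sum>i=1..q. (if i \<le> p then real (X i \<omega>) / real p else 0) - real (X i \<omega>) / real q)"
      by (intro sum.cong refl) (simp add: w_def left_diff_distrib)
    then show ?thesis
      unfolding D_def sum_subtractf restrict by (simp only: sum_divide_distrib)
  qed
  show "integrable M (\<lambda>\<omega>. (D \<omega>)\<^sup>2)"
    unfolding D by (rule expectation_linear_combination_square) auto
  have sum0: "(\<Sum>i=1..q. w i) = 0"
    unfolding w_def sum_subtractf restrict using assms(1,2) by simp
  have "(\<Sum>i=1..q. (w i)\<^sup>2)
      = (\<Sum>i=1..q. (if i \<le> p then (1 / real p)\<^sup>2 - 2 / (real p * real q) else 0) + (1 / real q)\<^sup>2)"
    by (intro sum.cong refl) (simp add: w_def power2_diff)
  also have "\<dots> = 1 / real p - 1 / real q"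
  proof -
    have "0 < p" "0 < q" using assms(1,2) by auto
    then show ?thesis
      unfolding sum.distrib restrict by (simp add: field_simps power2_eq_square)
  qed
  finally have sum_sq: "(\<Sum>i=1..q. (w i)\<^sup>2) = 1 / real p - 1 / real q" .
  \<comment> \<open>\<open>prob_all_one\<close> speaks of \<open>m (card S)\<close>; explicit sets
    of one and two labels exhibit \<open>m 1\<close> and \<open>m 2\<close> as
    probabilities.\<close>
  have card: "card {1::nat} = 1" "card {1::nat, 2} = 2"
    by simp_all
  have "m (card {1::nat}) \<le> 1"
    by (subst prob_all_one[symmetric]) simp_all
  moreover have "0 \<le> m (card {1::nat, 2})"
    by (subst prob_all_one[symmetric]) simp_all
  ultimately have "m 1 \<le> 1" "0 \<le> m 2"
    by (simp_all only: card)
  have "expectation (\<lambda>\<omega>. (D \<omega>)\<^sup>2) = m 2 * 0\<^sup>2 + (m 1 - m 2) * (1 / real p - 1 / real q)"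
    unfolding D sum0[symmetric] sum_sq[symmetric]
    by (rule expectation_linear_combination_square(2)) auto
  also have "\<dots> \<le> 1 * (1 / real p - 1 / real q)"
  proof -
    have "0 \<le> 1 / real p - 1 / real q"
      using assms(1,2) by (simp add: frac_le)
    moreover have "m 1 - m 2 \<le> 1"
      using \<open>m 1 \<le> 1\<close> \<open>0 \<le> m 2\<close> by linarith
    ultimately have "(m 1 - m 2) * (1 / real p - 1 / real q) \<le> 1 * (1 / real p - 1 / real q)"
      by (rule mult_right_mono[rotated])
    then show ?thesis
      by simp
  qed
  finally show "expectation (\<lambda>\<omega>. (D \<omega>)\<^sup>2) \<le> 1 / real p"
    by (rule order_trans) simp
qed

text \<open>Consecutive averages along fourth powers have summable \<open>L\<^sup>1\<close>
  distances, so their differences are almost surely absolutely summable. Telescoping gives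
  convergence along fourth powers, and interpolation extends it to all \<open>p\<close>.\<close>

lemma AE_convergent_averages:
  "AE \<omega> in M. convergent (\<lambda>p. (\<Sum>i=1..p. real (X i \<omega>)) / real p)"
proof -
  define s where "s p \<omega> = (\<Sum>i=1..p. real (X i \<omega>)) / real p" for p \<omega>
  \<comment> \<open>Fourth powers bound the second moment of \<open>d k\<close> by
    \<open>1/(k+1)^4\<close>, hence its first absolute moment by a multiple of
    \<open>1/(k+1)^2\<close>. Squares would only yield the harmonic bound \<open>1/(k+1)\<close>.
    The shift by \<open>Suc\<close> keeps the number of averaged bits positive.\<close>
  define d where "d k \<omega> = s (Suc k ^ 4) \<omega> - s (Suc (Suc k) ^ 4) \<omega>" for k \<omega>
  have [measurable]: "s p \<in> borel_measurable M" for p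
    unfolding s_def by (rule averages_measurable)
  have d_sq: "integrable M (\<lambda>\<omega>. (d k \<omega>)\<^sup>2)" "expectation (\<lambda>\<omega>. (d k \<omega>)\<^sup>2) \<le> 1 / real (Suc k ^ 4)" for k
    unfolding d_def s_def
    by (rule averages_difference_square; simp add: power_mono del: power_Suc)+
  have d_int: "integrable M (d k)" for k
    using averages_bounds unfolding d_def s_def[symmetric]
    by (intro Bochner_Integration.integrable_diff integrable_const_bound[where B = 1]) auto
  have d_abs: "expectation (\<lambda>\<omega>. \<bar>d k \<omega>\<bar>) \<le> 2 * (1 / real (Suc k) ^ 2)" for k
  proof -
    define c where "c = real (Suc k) ^ 2"
    have c: "c > 0" by (simp add: c_def)
    \<comment> \<open>AM-GM; the weight \<open>c\<close> is chosen so that both terms become \<open>1 / (k + 1)\<^sup>2\<close>.\<close>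
    have "\<bar>d k \<omega>\<bar> \<le> c * (d k \<omega>)\<^sup>2 + 1 / c" for \<omega>
    proof -
      have "0 \<le> (c * \<bar>d k \<omega>\<bar> - 1)\<^sup>2 + c * \<bar>d k \<omega>\<bar>" using c by simp
      then have "c * \<bar>d k \<omega>\<bar> \<le> c * (c * (d k \<omega>)\<^sup>2 + 1 / c)"
        using c by (simp add: power2_eq_square algebra_simps)
      then show ?thesis using c by simp
    qed
    then have "expectation (\<lambda>\<omega>. \<bar>d k \<omega>\<bar>) \<le> expectation (\<lambda>\<omega>. c * (d k \<omega>)\<^sup>2 + 1 / c)"
      using d_int d_sq(1) by (intro integral_mono) auto
    also have "\<dots> = c * expectation (\<lambda>\<omega>. (d k \<omega>)\<^sup>2) + 1 / c"
      using d_sq(1) by (simp add: prob_space)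
    also have "\<dots> \<le> c * (1 / real (Suc k ^ 4)) + 1 / c"
      using c d_sq(2) by (intro add_right_mono mult_left_mono) auto
    also have "c * (1 / real (Suc k ^ 4)) = 1 / c"
      using c unfolding c_def by (simp add: field_simps flip: power_add del: of_nat_Suc)
    finally show ?thesis
      by (simp add: c_def)
  qed
  have "summable (\<lambda>k. 2 * (1 / real (Suc k) ^ 2))"
    using inverse_power_summable[of 2, where 'a = real]
    by (intro summable_mult iffD2[OF summable_Suc_iff]) (simp add: inverse_eq_divide)
  then have "summable (\<lambda>k. expectation (\<lambda>\<omega>. \<bar>d k \<omega>\<bar>))"
    by (rule summable_comparison_test_ev[rotated]) (use d_abs in \<open>auto intro!: always_eventually\<close>)
  then have "AE \<omega> in M. summable (\<lambda>k. \<bar>d k \<omega>\<bar>)"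
    by (rule AE_summable_abs[OF d_int])
  then show ?thesis
  proof eventually_elim
    case (elim \<omega>)
    then have "summable (\<lambda>k. d k \<omega>)"
      by (rule summable_rabs_cancel)
    then have "convergent (\<lambda>n. \<Sum>k<n. d k \<omega>)"
      by (simp add: summable_iff_convergent)
    moreover have "(\<Sum>k<n. d k \<omega>) = s 1 \<omega> - s (Suc n ^ 4) \<omega>" for n
      unfolding d_def using sum_lessThan_telescope'[of "\<lambda>k. s (Suc k ^ 4) \<omega>" n] by simp
    ultimately obtain l where "(\<lambda>n. s 1 \<omega> - s (Suc n ^ 4) \<omega>) \<longlonglongrightarrow> l"
      by (auto simp: convergent_def)
    then have "(\<lambda>n. s 1 \<omega> - (s 1 \<omega> - s (Suc n ^ 4) \<omega>)) \<longlonglongrightarrow> s 1 \<omega> - l"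
      by (intro tendsto_intros)
    then have "(\<lambda>n. s (Suc n ^ 4) \<omega>) \<longlonglongrightarrow> s 1 \<omega> - l"
      by simp
    then have "(\<lambda>n. s (n ^ 4) \<omega>) \<longlonglongrightarrow> s 1 \<omega> - l"
      by (rule LIMSEQ_imp_Suc)
    then have "(\<lambda>p. s p \<omega>) \<longlonglongrightarrow> s 1 \<omega> - l"
      unfolding s_def by (intro LIMSEQ_averages_from_fourth_powers) auto
    then show ?case
      unfolding s_def by (rule convergentI)
  qed
qed

text \<open>The binomial counts the \<open>n\<close>-subsets of the set \<open>T\<close> of ones in
  \<open>{1..p}\<close>. It is thus the sum, over all \<open>n\<close>-subsets of
  \<open>{1..p}\<close>, of products of bits, each of expectation \<open>m n\<close>.\<close>

lemma expectation_binomial_sum_bits: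
  "expectation (\<lambda>\<omega>. real ((\<Sum>i=1..p. X i \<omega>) choose n)) = real (p choose n) * m n"
proof -
  let ?F = "{S. S \<subseteq> {1..p} \<and> card S = n}"
  have eq: "real ((\<Sum>i=1..p. X i \<omega>) choose n) = (\<Sum>S\<in>?F. \<Prod>i\<in>S. real (X i \<omega>))" if \<omega>: "\<omega> \<in> space M" for \<omega>
  proof -
    define T where "T = {i\<in>{1..p}. X i \<omega> = 1}"
    have "(\<Sum>i=1..p. X i \<omega>) = (\<Sum>i=1..p. if X i \<omega> = 1 then 1 else 0)"
      using bit_cases[OF _ \<omega>] by (intro sum.cong) fastforce+
    also have "\<dots> = card T"
      by (simp add: T_def sum.If_cases Int_def)
    finally have "(\<Sum>i=1..p. X i \<omega>) choose n = card {S. S \<subseteq> T \<and> card S = n}"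
      by (simp add: n_subsets T_def)
    moreover have "(\<Prod>i\<in>S. real (X i \<omega>)) = (if S \<subseteq> T then 1 else 0)" if "S \<in> ?F" for S
    proof (cases "S \<subseteq> T")
      case False
      then obtain i where "i \<in> S" "i \<notin> T" by blast
      with that have "i \<in> S" "X i \<omega> = 0"
        using bit_cases[OF _ \<omega>, of i] by (auto simp: T_def)
      moreover have "finite S" using that finite_subset by auto
      ultimately show ?thesis using False by (auto simp: prod_zero_iff)
    qed (auto simp: T_def intro!: prod.neutral)
    then have "(\<Sum>S\<in>?F. \<Prod>i\<in>S. real (X i \<omega>)) = (\<Sum>S\<in>?F. if S \<subseteq> T then 1 else 0)"
      by (intro sum.cong) auto
    moreover have "?F \<inter> {S. S \<subseteq> T} = {S. S \<subseteq> T \<and> card S = n}"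
      by (auto simp: T_def)
    moreover have "finite ?F"
      by (rule finite_subset[of _ "Pow {1..p}"]) auto
    ultimately show ?thesis
      by (simp add: sum.If_cases)
  qed
  have F: "finite S \<and> S \<subseteq> {1..}" if "S \<in> ?F" for S
    using that finite_subset by fastforce
  have "expectation (\<lambda>\<omega>. real ((\<Sum>i=1..p. X i \<omega>) choose n)) = expectation (\<lambda>\<omega>. \<Sum>S\<in>?F. \<Prod>i\<in>S. real (X i \<omega>))"
    by (intro Bochner_Integration.integral_cong eq refl)
  also have "\<dots> = (\<Sum>S\<in>?F. expectation (\<lambda>\<omega>. \<Prod>i\<in>S. real (X i \<omega>)))"
    using F by (intro Bochner_Integration.integral_sum integrable_prod_bits) auto
  also have "\<dots> = (\<Sum>S\<in>?F. m n)"
    using F by (intro sum.cong refl) (auto simp: expectation_prod_bits)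
  finally show ?thesis
    by (simp add: n_subsets)
qed

text \<open>Dominated convergence for the ratios \<open>R p\<close>, whose expectation is already
  equal to \<open>m n\<close> once \<open>n \<le> p\<close>.\<close>

lemma expectation_lim_averages_power:
  "expectation (\<lambda>\<omega>. lim (\<lambda>p. 1 / real p * (\<Sum>i=1..p. real (X i \<omega>))) ^ n) = m n"
proof -
  define s where "s p \<omega> = (\<Sum>i=1..p. real (X i \<omega>)) / real p" for p \<omega>
  have [measurable]: "s p \<in> borel_measurable M" for p
    unfolding s_def by (rule averages_measurable)
  have sum_measurable[measurable]: "(\<lambda>\<omega>. \<Sum>i=1..p. X i \<omega>) \<in> M \<rightarrow>\<^sub>M count_space UNIV" for p
  proof (induction p)
    case (Suc p)
    have [measurable]: "X (Suc p) \<in> M \<rightarrow>\<^sub>M count_space UNIV"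
      by (rule bit_measurable) simp
    from Suc[measurable] show ?case
      unfolding sum.cl_ivl_Suc by simp
  qed simp
  \<comment> \<open>For \<open>p < n\<close> both binomials are 0 and division by zero makes
    \<open>R p\<close> equal to 0, so the bound by 1 holds for every \<open>p\<close>.\<close>
  define R where "R p \<omega> = real ((\<Sum>i=1..p. X i \<omega>) choose n) / real (p choose n)" for p \<omega>
  have R_measurable: "R p \<in> borel_measurable M" for p
    unfolding R_def by measurable
  have R_bound: "\<bar>R p \<omega>\<bar> \<le> 1" if "\<omega> \<in> space M" for p \<omega>
  proof -
    have "(\<Sum>i=1..p. X i \<omega>) \<le> (\<Sum>i=1..p. 1)"
      using bit_cases[OF _ that] by (intro sum_mono) fastforce
    then have "(\<Sum>i=1..p. X i \<omega>) choose n \<le> p choose n"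
      by (intro binomial_right_mono) simp
    then show ?thesis
      by (auto simp: R_def divide_le_eq_1 not_less)
  qed
  have "(\<lambda>p. expectation (R p)) \<longlonglongrightarrow> expectation (\<lambda>\<omega>. lim (\<lambda>p. s p \<omega>) ^ n)"
  proof (rule integral_dominated_convergence[where w = "\<lambda>_. 1"])
    show "AE \<omega> in M. (\<lambda>p. R p \<omega>) \<longlonglongrightarrow> lim (\<lambda>p. s p \<omega>) ^ n"
      using AE_convergent_averages
    proof eventually_elim
      case (elim \<omega>)
      then have "(\<lambda>p. real (\<Sum>i=1..p. X i \<omega>) / real p) \<longlonglongrightarrow> lim (\<lambda>p. s p \<omega>)"
        by (simp add: convergent_LIMSEQ_iff s_def)
      then show ?case
        unfolding R_def by (rule LIMSEQ_binomial_ratio)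
    qed
  qed (use R_bound R_measurable in auto)
  moreover have "expectation (R p) = m n" if "n \<le> p" for p
  proof -
    have "expectation (R p) = real (p choose n) * m n / real (p choose n)"
      unfolding R_def Bochner_Integration.integral_divide_zero expectation_binomial_sum_bits ..
    with that show ?thesis
      by simp
  qed
  then have "(\<lambda>p. expectation (R p)) \<longlonglongrightarrow> m n"
    by (intro tendsto_eventually) (auto simp: eventually_sequentially)
  ultimately show ?thesis
    unfolding s_def by (simp add: LIMSEQ_unique)
qed

end

end

subsection \<open>Images under a label-forgetful mapping\<close>

lemma space_subset_space: "space subset_space = nonempty_subsets"
  unfolding subset_space_def by (rule space_measure_of) auto

lemma space_mapping_space: "space mapping_space = ({1..} \<rightarrow>\<^sub>E nonempty_subsets)"
  by (simp add: mapping_space_def space_PiM space_subset_space)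

text \<open>Positive labels give generators and the label 0 gives the empty event; covering both
  allows quantification over all of \<open>nat\<close>.\<close>

lemma membership_event: "{A \<in> nonempty_subsets. j \<in> A} \<in> sets subset_space"
proof (cases "j \<in> {1..}")
  case True
  then show ?thesis
    unfolding subset_space_def by (subst sets_measure_of) auto
next
  case False
  then have "{A \<in> nonempty_subsets. j \<in> A} = {}"
    by (auto simp: nonempty_subsets_def)
  then show ?thesis
    by (simp only: sets.empty_sets)
qed

text \<open>An event on the space of mappings rather than on a sample space: it can be pulled back
  along \<open>L\<close> and along each copy \<open>Ls k\<close>, so equality in law and
  independence of the copies both apply to it.\<close>

definition image_event :: "nat set \<Rightarrow> nat set \<Rightarrow> (nat \<Rightarrow> nat set) set" where
  "image_event S T = {f \<in> space mapping_space. (\<Union>i\<in>S. f i) = T}"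

text \<open>Equality of the union with \<open>T\<close> is tested label by label, which is a
  countable conjunction of conditions on countable unions of membership events.\<close>

lemma image_event_measurable:
  assumes "S \<subseteq> {1..}"
  shows "image_event S T \<in> sets mapping_space"
proof -
  have component: "{f \<in> space mapping_space. j \<in> f i} \<in> sets mapping_space" if "i \<in> S" for i j
  proof -
    have "i \<in> {1..}"
      using that assms by blast
    then have "(\<lambda>f. f i) \<in> mapping_space \<rightarrow>\<^sub>M subset_space"
      unfolding mapping_space_def by (rule measurable_component_singleton)
    then have "(\<lambda>f. f i) -` {A \<in> nonempty_subsets. j \<in> A} \<inter> space mapping_space \<in> sets mapping_space"
      using membership_event by (rule measurable_sets)
    also have "(\<lambda>f. f i) -` {A \<in> nonempty_subsets. j \<in> A} \<inter> space mapping_space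
        = {f \<in> space mapping_space. j \<in> f i}"
      using \<open>i \<in> {1..}\<close> PiE_mem[of _ "{1..}" "\<lambda>_. nonempty_subsets" i]
      unfolding space_mapping_space by blast
    finally show ?thesis .
  qed
  then have "{f \<in> space mapping_space. \<exists>i\<in>S. j \<in> f i} \<in> sets mapping_space" for j
    by (intro sets.sets_Collect_countable_Ex') auto
  then have "{f \<in> space mapping_space. \<forall>j. (\<exists>i\<in>S. j \<in> f i) = (j \<in> T)} \<in> sets mapping_space"
    by (intro sets.sets_Collect_countable_All) (auto intro: sets.sets_Collect_neg)
  also have "{f \<in> space mapping_space. \<forall>j. (\<exists>i\<in>S. j \<in> f i) = (j \<in> T)} = image_event S T"
    by (auto simp: image_event_def)
  finally show ?thesis .
qed

lemma mapping_sequence_measurable: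
  "random_mapping M L \<Longrightarrow> mapping_sequence L \<in> M \<rightarrow>\<^sub>M mapping_space"
  unfolding mapping_sequence_def[abs_def] mapping_space_def random_mapping_def
  by (intro measurable_restrict) auto

lemma mapping_sequence_in_space:
  assumes "random_mapping M L" "\<omega> \<in> space M"
  shows "mapping_sequence L \<omega> \<in> space mapping_space"
  using measurable_space[OF mapping_sequence_measurable[OF assms(1)] assms(2)] .

lemma UN_mapping_sequence:
  "S \<subseteq> {1..} \<Longrightarrow> (\<Union>i\<in>S. mapping_sequence L \<omega> i) = mapping_image L S \<omega>"
  by (auto simp: mapping_sequence_def mapping_image_def subset_iff)

lemma vimage_image_event:
  assumes "random_mapping M L" "S \<subseteq> {1..}"
  shows "mapping_sequence L -` image_event S T \<inter> space M = {\<omega> \<in> space M. mapping_image L S \<omega> = T}"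
  using mapping_sequence_in_space[OF assms(1)]
  unfolding image_event_def vimage_def Int_def mem_Collect_eq UN_mapping_sequence[OF assms(2)]
  by blast

lemma mapping_image_event:
  assumes "random_mapping M L" "S \<subseteq> {1..}"
  shows "{\<omega> \<in> space M. mapping_image L S \<omega> = T} \<in> sets M"
  using measurable_sets[OF mapping_sequence_measurable image_event_measurable] assms
  by (simp flip: vimage_image_event)

lemma mapping_image_subset:
  assumes "random_mapping M L" "S \<subseteq> {1..}" "\<omega> \<in> space M"
  shows "mapping_image L S \<omega> \<subseteq> {1..}" "S \<noteq> {} \<Longrightarrow> mapping_image L S \<omega> \<noteq> {}"
proof -
  have "L i \<omega> \<in> nonempty_subsets" if "i \<in> S" for i
    using that assms measurable_space[of "L i" M subset_space \<omega>]
    by (auto simp: random_mapping_def space_subset_space)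
  then show "mapping_image L S \<omega> \<subseteq> {1..}" "S \<noteq> {} \<Longrightarrow> mapping_image L S \<omega> \<noteq> {}"
    by (auto simp: mapping_image_def nonempty_subsets_def)
qed

text \<open>Finite sets of naturals are enumerated by \<open>set_decode\<close>, so a condition on a
  finite cardinality becomes a countable union over codes \<open>t\<close>.\<close>

lemma ecard_eq_enat_iff: "ecard A = enat m \<longleftrightarrow> (\<exists>t. card (set_decode t) = m \<and> A = set_decode t)"
  by (auto simp: ecard_def) (metis set_encode_inverse)

lemma ecard_event:
  assumes "random_mapping M L" "S \<subseteq> {1..}"
  shows "{\<omega> \<in> space M. ecard (mapping_image L S \<omega>) = enat m} \<in> sets M"
  unfolding ecard_eq_enat_iff using mapping_image_event[OF assms]
  by (intro sets.sets_Collect_countable_Ex sets.sets_Collect_conj sets.sets_Collect_const)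

text \<open>The target is countable, so singletons suffice; the value \<open>\<infinity>\<close> is
  the complement of all finite values.\<close>

lemma ecard_measurable:
  assumes "random_mapping M L" "S \<subseteq> {1..}"
  shows "(\<lambda>\<omega>. ecard (mapping_image L S \<omega>)) \<in> M \<rightarrow>\<^sub>M count_space UNIV"
proof -
  have finite_values: "(\<lambda>\<omega>. ecard (mapping_image L S \<omega>)) -` {enat m} \<inter> space M \<in> sets M" for m
    using ecard_event[OF assms, of m] by (simp add: vimage_def Int_def conj_commute)
  have "(\<lambda>\<omega>. ecard (mapping_image L S \<omega>)) -` {\<infinity>} \<inter> space M
      = space M - (\<Union>m. (\<lambda>\<omega>. ecard (mapping_image L S \<omega>)) -` {enat m} \<inter> space M)"
    by (auto simp: ecard_def split: if_splits)
  moreover have "\<dots> \<in> sets M"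
    using finite_values by (intro sets.Diff sets.top sets.countable_UN) auto
  ultimately have "(\<lambda>\<omega>. ecard (mapping_image L S \<omega>)) -` {e} \<inter> space M \<in> sets M" for e
    using finite_values by (cases e) metis+
  then show ?thesis
    by (subst measurable_count_space_eq2_countable) auto
qed

text \<open>Label-forgetfulness enters here: it compares \<open>S\<close> with the initial segment
  \<open>{1..card S}\<close>.\<close>

lemma prob_ecard_eq_block_transition:
  assumes L: "random_mapping M L" "label_forgetful M L" and S: "finite S" "S \<subseteq> {1..}"
  shows "\<P>(\<omega> in M. ecard (mapping_image L S \<omega>) = enat m) = block_transition M L (card S) m"
proof -
  have distr: "\<P>(\<omega> in M. ecard (mapping_image L S' \<omega>) = enat m)
      = measure (distr M (count_space UNIV) (\<lambda>\<omega>. ecard (mapping_image L S' \<omega>))) {enat m}"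
    if "S' \<subseteq> {1..}" for S'
    using ecard_measurable[OF L(1) that]
    by (simp add: measure_distr vimage_def Int_def conj_commute)
  have "ecard S = ecard {1..card S}"
    using S(1) by (simp add: ecard_def)
  moreover have "{1..card S} \<subseteq> {1..}"
    by auto
  ultimately have "distr M (count_space UNIV) (\<lambda>\<omega>. ecard (mapping_image L S \<omega>))
      = distr M (count_space UNIV) (\<lambda>\<omega>. ecard (mapping_image L {1..card S} \<omega>))"
    using L(2) S(2) unfolding label_forgetful_def by blast
  then show ?thesis
    using distr[OF S(2)] distr[of "{1..card S}"] by (auto simp: block_transition_def)
qed

lemma AE_finite_mapping_image:
  assumes fin: "\<forall>j\<in>{1..}. AE \<omega> in M. finite (mapping_image L {1..j} \<omega>)"
    and S: "finite S" "S \<subseteq> {1..}"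
  shows "AE \<omega> in M. finite (mapping_image L S \<omega>)"
proof -
  \<comment> \<open>Inserting 0 gives \<open>Max\<close> a non-empty argument when \<open>S\<close>
    is empty, and \<open>Suc\<close> makes the length of the segment positive, as \<open>fin\<close>
    requires.\<close>
  have "S \<subseteq> {1..Suc (Max (insert 0 S))}"
  proof
    fix i assume "i \<in> S"
    then have "1 \<le> i" "i \<le> Max (insert 0 S)"
      using S by auto
    then show "i \<in> {1..Suc (Max (insert 0 S))}"
      by simp
  qed
  moreover have "AE \<omega> in M. finite (mapping_image L {1..Suc (Max (insert 0 S))} \<omega>)"
    using fin by (rule bspec) simp
  ultimately show ?thesis
    by (auto elim!: eventually_mono intro: finite_subset simp: mapping_image_def)
qed

text \<open>One expectation is split in two ways, over the cardinality of the image and over the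
  image itself, the latter through codes of finite sets. The common limit lets a sum over image sets
  be replaced by a sum against block transitions.\<close>

lemma
  fixes g :: "nat \<Rightarrow> real"
  assumes L: "random_mapping M L" "label_forgetful M L"
    and fin: "\<forall>j\<in>{1..}. AE \<omega> in M. finite (mapping_image L {1..j} \<omega>)"
    and S: "finite S" "S \<subseteq> {1..}"
    and g: "\<And>m. 0 \<le> g m" "\<And>m. g m \<le> 1"
  shows sums_block_transition: "(\<lambda>m. block_transition M L (card S) m * g m)
      sums (\<integral>\<omega>. g (card (mapping_image L S \<omega>)) \<partial>M)"
    and sums_prob_mapping_image: "(\<lambda>t. \<P>(\<omega> in M. mapping_image L S \<omega> = set_decode t) * g (card (set_decode t)))
      sums (\<integral>\<omega>. g (card (mapping_image L S \<omega>)) \<partial>M)"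
proof -
  interpret prob_space M
    using L(1) by (simp add: random_mapping_def)
  note AE_fin = AE_finite_mapping_image[OF fin S]
  have "integrable M (\<lambda>\<omega>. g (card (mapping_image L S \<omega>)))"
  proof (rule integrable_const_bound[where B = 1])
    \<comment> \<open>Measurability is inherited from \<open>ecard\<close>. The branch for
      \<open>\<infinity>\<close> is \<open>g 0\<close> because \<open>card\<close> is 0 on infinite
      sets.\<close>
    have "(\<lambda>\<omega>. case ecard (mapping_image L S \<omega>) of enat m \<Rightarrow> g m | \<infinity> \<Rightarrow> g 0) \<in> borel_measurable M"
      by (rule measurable_compose[OF ecard_measurable[OF L(1) S(2)]]) simp
    moreover have "(case ecard A of enat m \<Rightarrow> g m | \<infinity> \<Rightarrow> g 0) = g (card A)" for A
      by (simp add: ecard_def)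
    ultimately show "(\<lambda>\<omega>. g (card (mapping_image L S \<omega>))) \<in> borel_measurable M"
      by simp
  qed (use g in auto)
  note sums = sums_expectation_partition[OF this]
  have "(\<lambda>m. expectation (\<lambda>\<omega>. g (card (mapping_image L S \<omega>))
        * indicator {\<omega> \<in> space M. ecard (mapping_image L S \<omega>) = enat m} \<omega>))
      sums expectation (\<lambda>\<omega>. g (card (mapping_image L S \<omega>)))"
  proof (rule sums)
    show "AE \<omega> in M. \<exists>m. \<omega> \<in> {\<omega> \<in> space M. ecard (mapping_image L S \<omega>) = enat m}"
      using AE_fin AE_space by eventually_elim (simp add: ecard_def)
  qed (use ecard_event[OF L(1) S(2)] in \<open>auto simp: disjoint_family_on_def\<close>)
  moreover have "expectation (\<lambda>\<omega>. g (card (mapping_image L S \<omega>))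
        * indicator {\<omega> \<in> space M. ecard (mapping_image L S \<omega>) = enat m} \<omega>)
      = block_transition M L (card S) m * g m" for m
  proof -
    have "g (card (mapping_image L S \<omega>)) * indicator {\<omega> \<in> space M. ecard (mapping_image L S \<omega>) = enat m} \<omega>
        = g m * indicator {\<omega> \<in> space M. ecard (mapping_image L S \<omega>) = enat m} \<omega>" for \<omega>
      by (auto simp: indicator_def ecard_def split: if_splits)
    then have "expectation (\<lambda>\<omega>. g (card (mapping_image L S \<omega>))
        * indicator {\<omega> \<in> space M. ecard (mapping_image L S \<omega>) = enat m} \<omega>)
      = g m * prob {\<omega> \<in> space M. ecard (mapping_image L S \<omega>) = enat m}"
      using ecard_event[OF L(1) S(2), of m] by (simp only: integral_mult_right_zero) simp
    then show ?thesis
      by (simp add: prob_ecard_eq_block_transition[OF L S])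
  qed
  ultimately show "(\<lambda>m. block_transition M L (card S) m * g m)
      sums (\<integral>\<omega>. g (card (mapping_image L S \<omega>)) \<partial>M)"
    by simp
  have "(\<lambda>t. expectation (\<lambda>\<omega>. g (card (mapping_image L S \<omega>))
        * indicator {\<omega> \<in> space M. mapping_image L S \<omega> = set_decode t} \<omega>))
      sums expectation (\<lambda>\<omega>. g (card (mapping_image L S \<omega>)))"
  proof (rule sums)
    show "AE \<omega> in M. \<exists>t. \<omega> \<in> {\<omega> \<in> space M. mapping_image L S \<omega> = set_decode t}"
      using AE_fin AE_space by eventually_elim (auto, metis set_encode_inverse)
    show "disjoint_family (\<lambda>t. {\<omega> \<in> space M. mapping_image L S \<omega> = set_decode t})"
      unfolding disjoint_family_on_def by (auto, metis set_decode_inverse)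
  qed (use mapping_image_event[OF L(1) S(2)] in auto)
  moreover have "expectation (\<lambda>\<omega>. g (card (mapping_image L S \<omega>))
        * indicator {\<omega> \<in> space M. mapping_image L S \<omega> = set_decode t} \<omega>)
      = \<P>(\<omega> in M. mapping_image L S \<omega> = set_decode t) * g (card (set_decode t))" for t
  proof -
    have "g (card (mapping_image L S \<omega>)) * indicator {\<omega> \<in> space M. mapping_image L S \<omega> = set_decode t} \<omega>
        = g (card (set_decode t)) * indicator {\<omega> \<in> space M. mapping_image L S \<omega> = set_decode t} \<omega>" for \<omega>
      by (auto simp: indicator_def)
    then show ?thesis
      using mapping_image_event[OF L(1) S(2), of "set_decode t"]
      by (simp only: integral_mult_right_zero) simp
  qed
  ultimately show "(\<lambda>t. \<P>(\<omega> in M. mapping_image L S \<omega> = set_decode t) * g (card (set_decode t)))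
      sums (\<integral>\<omega>. g (card (mapping_image L S \<omega>)) \<partial>M)"
    by simp
qed

section \<open>The common value of both sides\<close>

text \<open>The \<open>k\<close>-fold application of the transition operator with kernel
  \<open>p\<close> to the function sending \<open>n\<close> to \<open>x ^ n\<close>. For block
  transitions from \<open>n = 0\<close> the image of the empty set is empty, so the value stays 1,
  as it should for an empty set of bits.\<close>

primrec dual_moment :: "(nat \<Rightarrow> nat \<Rightarrow> real) \<Rightarrow> real \<Rightarrow> nat \<Rightarrow> nat \<Rightarrow> real" where
  "dual_moment p x 0 n = x ^ n"
| "dual_moment p x (Suc k) n = (\<Sum>m. p n m * dual_moment p x k m)"

text \<open>Each further step is the expectation of the preceding function at a random cardinality,
  so values stay in the unit interval. These bounds in turn justify convergence of the series at the
  next step.\<close>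

lemma dual_moment_bounds:
  assumes L: "random_mapping M L" "label_forgetful M L"
    and fin: "\<forall>j\<in>{1..}. AE \<omega> in M. finite (mapping_image L {1..j} \<omega>)"
    and x: "x \<in> {0..1}"
  shows "0 \<le> dual_moment (block_transition M L) x k n \<and> dual_moment (block_transition M L) x k n \<le> 1"
proof (induction k arbitrary: n)
  case 0
  then show ?case
    using x by (simp add: power_le_one)
next
  case (Suc k)
  interpret prob_space M
    using L(1) by (simp add: random_mapping_def)
  let ?u = "dual_moment (block_transition M L) x k"
  have "{1..n} \<subseteq> {1..}"
    by auto
  from sums_block_transition[OF L fin _ this, of ?u] Suc
  have "dual_moment (block_transition M L) x (Suc k) n = expectation (\<lambda>\<omega>. ?u (card (mapping_image L {1..n} \<omega>)))"
    by (simp add: sums_iff)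
  moreover have "expectation (\<lambda>\<omega>. ?u (card (mapping_image L {1..n} \<omega>))) \<le> expectation (\<lambda>_. 1)"
    by (rule integral_mono') (use Suc in auto)
  ultimately show ?case
    using Suc by (simp add: prob_space)
qed

text \<open>The recursion in the form needed by each process: over cardinalities for the
  block-counting chain, over image sets for the forward bits.\<close>

lemma sums_dual_moment_Suc:
  assumes L: "random_mapping M L" "label_forgetful M L"
    and fin: "\<forall>j\<in>{1..}. AE \<omega> in M. finite (mapping_image L {1..j} \<omega>)"
    and x: "x \<in> {0..1}" and S: "finite S" "S \<subseteq> {1..}"
  defines "u \<equiv> dual_moment (block_transition M L) x"
  shows "(\<lambda>m. block_transition M L (card S) m * u k m) sums u (Suc k) (card S)"
    and "(\<lambda>t. \<P>(\<omega> in M. mapping_image L S \<omega> = set_decode t) * u k (card (set_decode t)))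
      sums u (Suc k) (card S)"
proof -
  have g: "0 \<le> u k m" "u k m \<le> 1" for m
    using dual_moment_bounds[OF L fin x] by (auto simp: u_def)
  have eq: "u (Suc k) (card S) = (\<integral>\<omega>. u k (card (mapping_image L S \<omega>)) \<partial>M)"
    using sums_block_transition[OF L fin S g] by (simp add: u_def sums_iff)
  show "(\<lambda>m. block_transition M L (card S) m * u k m) sums u (Suc k) (card S)"
    unfolding eq by (rule sums_block_transition[OF L fin S g])
  show "(\<lambda>t. \<P>(\<omega> in M. mapping_image L S \<omega> = set_decode t) * u k (card (set_decode t)))
      sums u (Suc k) (card S)"
    unfolding eq by (rule sums_prob_mapping_image[OF L fin S g])
qed

subsection \<open>The forward process\<close>

text \<open>A bijection from \<open>A\<close> to \<open>B\<close> is completed by one between their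
  complements in \<open>A \<union> B\<close>, which have equal size. Exchangeability is formulated
  for such finite permutations.\<close>

lemma ex_permutes_image:
  assumes "finite A" "finite B" "card A = card B"
  shows "\<exists>\<pi>. \<pi> permutes (A \<union> B) \<and> \<pi> ` A = B"
proof -
  let ?F = "A \<union> B"
  obtain f where f: "bij_betw f A B"
    using assms finite_same_card_bij by blast
  have "card (?F - A) = card (?F - B)"
    using assms by (simp add: card_Diff_subset)
  then obtain g where g: "bij_betw g (?F - A) (?F - B)"
    using assms finite_same_card_bij[of "?F - A" "?F - B"] by blast
  define \<pi> where "\<pi> i = (if i \<in> A then f i else if i \<in> ?F then g i else i)" for i
  have \<pi>_A: "bij_betw \<pi> A B"
    using f by (rule iffD1[OF bij_betw_cong, rotated]) (simp add: \<pi>_def)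
  have "bij_betw \<pi> (?F - A) (?F - B)"
    using g by (rule iffD1[OF bij_betw_cong, rotated]) (auto simp: \<pi>_def)
  with \<pi>_A have "bij_betw \<pi> (A \<union> (?F - A)) (B \<union> (?F - B))"
    by (rule bij_betw_combine) auto
  moreover have "A \<union> (?F - A) = ?F" "B \<union> (?F - B) = ?F"
    by auto
  ultimately have "\<pi> permutes ?F"
    by (intro bij_imp_permutes) (auto simp: \<pi>_def)
  with \<pi>_A show ?thesis
    by (auto simp: bij_betw_def)
qed

lemma all_one_event:
  assumes "finite S" "S \<subseteq> {1..}"
  shows "{f \<in> space bit_sequence_space. \<forall>i\<in>S. f i = 1} \<in> sets bit_sequence_space"
proof (rule sets.sets_Collect_finite_All[OF _ assms(1)])
  fix i assume "i \<in> S"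
  then have "i \<in> {1..}"
    using assms(2) by blast
  then have "(\<lambda>f. f i) \<in> bit_sequence_space \<rightarrow>\<^sub>M count_space {0, 1::nat}"
    unfolding bit_sequence_space_def by (rule measurable_component_singleton)
  then have "(\<lambda>f. f i) -` {1} \<inter> space bit_sequence_space \<in> sets bit_sequence_space"
    by (rule measurable_sets) simp
  also have "(\<lambda>f. f i) -` {1} \<inter> space bit_sequence_space = {f \<in> space bit_sequence_space. f i = 1}"
    by auto
  finally show "{f \<in> space bit_sequence_space. f i = 1} \<in> sets bit_sequence_space" .
qed

lemma bit_sequence_measurable:
  "(\<And>i. i \<in> {1..} \<Longrightarrow> X i \<in> P \<rightarrow>\<^sub>M count_space {0, 1}) \<Longrightarrow> bit_sequence X \<in> P \<rightarrow>\<^sub>M bit_sequence_space"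
  unfolding bit_sequence_def[abs_def] bit_sequence_space_def by (intro measurable_restrict) auto

lemma vimage_all_one_event:
  assumes "\<And>i. i \<in> {1..} \<Longrightarrow> X i \<in> P \<rightarrow>\<^sub>M count_space {0, 1}" "S \<subseteq> {1..}"
  shows "bit_sequence X -` {f \<in> space bit_sequence_space. \<forall>i\<in>S. f i = 1} \<inter> space P
    = {\<omega> \<in> space P. \<forall>i\<in>S. X i \<omega> = 1}"
proof -
  have "bit_sequence X \<omega> \<in> space bit_sequence_space" if "\<omega> \<in> space P" for \<omega>
    using measurable_space[OF bit_sequence_measurable[OF assms(1)] that] .
  moreover have "(\<forall>i\<in>S. bit_sequence X \<omega> i = 1) \<longleftrightarrow> (\<forall>i\<in>S. X i \<omega> = 1)" for \<omega>
    using assms(2) by (intro ball_cong refl) (auto simp: bit_sequence_def subset_iff)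
  ultimately show ?thesis
    by blast
qed

text \<open>Apply exchangeability to a permutation of \<open>{1..card S} \<union> S\<close> that
  carries the initial segment onto \<open>S\<close>.\<close>

lemma exchangeable_prob_all_one:
  assumes X: "exchangeable_bits P X" and S: "finite S" "S \<subseteq> {1..}"
  shows "\<P>(\<omega> in P. \<forall>i\<in>S. X i \<omega> = 1) = \<P>(\<omega> in P. \<forall>i\<in>{1..card S}. X i \<omega> = 1)"
proof -
  let ?I = "{1..card S}"
  let ?E = "{f \<in> space bit_sequence_space. \<forall>i\<in>?I. f i = 1}"
  have meas: "X i \<in> P \<rightarrow>\<^sub>M count_space {0, 1}" if "i \<in> {1..}" for i
    using X that by (auto simp: exchangeable_bits_def)
  obtain \<pi> where \<pi>: "\<pi> permutes (?I \<union> S)" "\<pi> ` ?I = S"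
    using ex_permutes_image[of ?I S] S by auto
  have F: "?I \<union> S \<subseteq> {1..}"
    using S by auto
  have "\<pi> i \<in> {1..}" if "i \<in> {1..}" for i
    using permutes_in_image[OF \<pi>(1), of i] permutes_not_in[OF \<pi>(1), of i] F that by fastforce
  then have meas\<pi>: "X (\<pi> i) \<in> P \<rightarrow>\<^sub>M count_space {0, 1}" if "i \<in> {1..}" for i
    using that meas by blast
  have E: "?E \<in> sets bit_sequence_space"
    by (rule all_one_event) auto
  have I: "?I \<subseteq> {1..}"
    by auto
  have "distr P bit_sequence_space (bit_sequence (\<lambda>i. X (\<pi> i))) = distr P bit_sequence_space (bit_sequence X)"
    using X \<pi>(1) F S(1) unfolding exchangeable_bits_def by blast
  then have "measure (distr P bit_sequence_space (bit_sequence (\<lambda>i. X (\<pi> i)))) ?E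
      = measure (distr P bit_sequence_space (bit_sequence X)) ?E"
    by simp
  then have "\<P>(\<omega> in P. \<forall>i\<in>?I. X (\<pi> i) \<omega> = 1) = \<P>(\<omega> in P. \<forall>i\<in>?I. X i \<omega> = 1)"
    using vimage_all_one_event[of X P ?I, OF meas I] vimage_all_one_event[of "\<lambda>i. X (\<pi> i)" P ?I, OF meas\<pi> I]
    by (simp only: measure_distr[OF bit_sequence_measurable[of X P, OF meas] E]
        measure_distr[OF bit_sequence_measurable[of "\<lambda>i. X (\<pi> i)" P, OF meas\<pi>] E])
  moreover have "(\<forall>i\<in>?I. X (\<pi> i) \<omega> = 1) \<longleftrightarrow> (\<forall>i\<in>S. X i \<omega> = 1)" for \<omega>
  proof -
    have "(\<forall>i\<in>?I. X (\<pi> i) \<omega> = 1) \<longleftrightarrow> (\<forall>i\<in>\<pi> ` ?I. X i \<omega> = 1)"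
      by simp
    then show ?thesis
      by (simp only: \<pi>(2))
  qed
  ultimately show ?thesis
    by simp
qed

text \<open>The infimum of a non-empty set of naturals is attained, so it is itself one of the bits
  and a lower bound for all of them.\<close>

lemma Inf_bits_eq_one_iff:
  fixes b :: "nat \<Rightarrow> nat"
  assumes "A \<noteq> {}" "\<And>j. j \<in> A \<Longrightarrow> b j \<in> {0, 1}"
  shows "(INF j\<in>A. b j) \<in> {0, 1}" "(INF j\<in>A. b j) = 1 \<longleftrightarrow> (\<forall>j\<in>A. b j = 1)"
proof -
  obtain i where i: "i \<in> A" "(INF j\<in>A. b j) = b i"
    using Inf_nat_def1[of "b ` A"] assms(1) by blast
  then show "(INF j\<in>A. b j) \<in> {0, 1}"
    using assms(2)[OF i(1)] by simp
  show "(INF j\<in>A. b j) = 1 \<longleftrightarrow> (\<forall>j\<in>A. b j = 1)"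
  proof
    assume 1: "(INF j\<in>A. b j) = 1"
    show "\<forall>j\<in>A. b j = 1"
    proof
      fix j assume "j \<in> A"
      then have "(INF j\<in>A. b j) \<le> b j"
        by (rule cINF_lower[OF bdd_below_bot])
      with 1 have "b j \<noteq> 0"
        by simp
      then show "b j = 1"
        using assms(2)[OF \<open>j \<in> A\<close>] by simp
    qed
  next
    assume "\<forall>j\<in>A. b j = 1"
    then show "(INF j\<in>A. b j) = 1"
      using i by simp
  qed
qed

section \<open>The forward recursion, its measurability and the law of its inputs\<close>

context
  fixes M :: "'a measure" and L :: "nat \<Rightarrow> 'a \<Rightarrow> nat set"
    and P :: "'b measure" and Ls :: "nat \<Rightarrow> nat \<Rightarrow> 'b \<Rightarrow> nat set" and X0 :: "nat \<Rightarrow> 'b \<Rightarrow> nat"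
  assumes forward_input: "forward_input M L P Ls X0"
begin

lemma
  shows forward_prob_space: "prob_space P"
    and forward_mapping: "k \<in> {1..} \<Longrightarrow> random_mapping P (Ls k)"
    and forward_mapping_distr: "k \<in> {1..} \<Longrightarrow>
      distr P mapping_space (mapping_sequence (Ls k)) = distr M mapping_space (mapping_sequence L)"
    and forward_mapping_indep: "prob_space.indep_vars P (\<lambda>_. mapping_space) (\<lambda>k. mapping_sequence (Ls k)) {1..}"
    and forward_exchangeable: "exchangeable_bits P X0"
    and forward_indep: "prob_space.indep_set P
       (sets (vimage_algebra (space P) (bit_sequence X0) bit_sequence_space))
       (sets (vimage_algebra (space P) (\<lambda>\<omega>. \<lambda>k\<in>{1..}. mapping_sequence (Ls k) \<omega>)
          (\<Pi>\<^sub>M k\<in>{1..}. mapping_space)))"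
  using forward_input by (auto simp: forward_input_def iid_copies_def)

interpretation prob_space P
  by (rule forward_prob_space)

lemma initial_bits_measurable: "i \<in> {1..} \<Longrightarrow> X0 i \<in> P \<rightarrow>\<^sub>M count_space {0, 1}"
  using forward_exchangeable by (auto simp: exchangeable_bits_def)

lemma forward_bits_in: "i \<in> {1..} \<Longrightarrow> \<omega> \<in> space P \<Longrightarrow> forward_bits Ls X0 k i \<omega> \<in> {0, 1}"
  and forward_bits_Suc_eq_one_iff: "i \<in> {1..} \<Longrightarrow> \<omega> \<in> space P \<Longrightarrow>
    forward_bits Ls X0 (Suc k) i \<omega> = 1 \<longleftrightarrow> (\<forall>j\<in>Ls (Suc k) i \<omega>. forward_bits Ls X0 k j \<omega> = 1)"
proof -
  have Ls: "Ls (Suc k) i \<omega> \<subseteq> {1..}" "Ls (Suc k) i \<omega> \<noteq> {}" if "i \<in> {1..}" "\<omega> \<in> space P" for k i \<omega>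
    using mapping_image_subset[OF forward_mapping, of "Suc k" "{i}" \<omega>] that
    by (auto simp: mapping_image_def)
  show bits: "forward_bits Ls X0 k i \<omega> \<in> {0, 1}" if "i \<in> {1..}" "\<omega> \<in> space P" for k i \<omega>
    using that
  proof (induction k arbitrary: i)
    case 0
    then show ?case
      using measurable_space[OF initial_bits_measurable] by simp
  next
    case (Suc k)
    have "(INF j\<in>Ls (Suc k) i \<omega>. forward_bits Ls X0 k j \<omega>) \<in> {0, 1}"
      using Ls[OF Suc.prems] Suc by (intro Inf_bits_eq_one_iff(1)) blast+
    then show ?case
      by simp
  qed
  show "forward_bits Ls X0 (Suc k) i \<omega> = 1 \<longleftrightarrow> (\<forall>j\<in>Ls (Suc k) i \<omega>. forward_bits Ls X0 k j \<omega> = 1)"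
    if "i \<in> {1..}" "\<omega> \<in> space P"
    unfolding forward_bits.simps using Ls[OF that] bits that(2)
    by (intro Inf_bits_eq_one_iff(2)) blast+
qed

text \<open>The pathwise core of the duality: one forward step of the bits is traded for one step of
  the set on which they are observed.\<close>

lemma forward_bits_Suc_all_one_iff:
  assumes "S \<subseteq> {1..}" "\<omega> \<in> space P"
  shows "(\<forall>i\<in>S. forward_bits Ls X0 (Suc k) i \<omega> = 1)
    \<longleftrightarrow> (\<forall>j\<in>mapping_image (Ls (Suc k)) S \<omega>. forward_bits Ls X0 k j \<omega> = 1)"
proof -
  have "(\<forall>i\<in>S. forward_bits Ls X0 (Suc k) i \<omega> = 1)
      \<longleftrightarrow> (\<forall>i\<in>S. \<forall>j\<in>Ls (Suc k) i \<omega>. forward_bits Ls X0 k j \<omega> = 1)"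
  proof (rule ball_cong[OF refl])
    fix i assume "i \<in> S"
    then have "i \<in> {1..}"
      using assms(1) by blast
    then show "forward_bits Ls X0 (Suc k) i \<omega> = 1 \<longleftrightarrow> (\<forall>j\<in>Ls (Suc k) i \<omega>. forward_bits Ls X0 k j \<omega> = 1)"
      using assms(2) by (rule forward_bits_Suc_eq_one_iff)
  qed
  also have "\<dots> \<longleftrightarrow> (\<forall>j\<in>mapping_image (Ls (Suc k)) S \<omega>. forward_bits Ls X0 k j \<omega> = 1)"
    by (simp only: mapping_image_def ball_UN)
  finally show ?thesis .
qed

text \<open>The infimum runs over a random set of labels. Quantifying over all fixed labels
  \<open>j\<close>, with membership of \<open>j\<close> as a premise, turns the event into a
  countable intersection.\<close>

lemma forward_bits_event:
  "i \<in> {1..} \<Longrightarrow> {\<omega> \<in> space P. forward_bits Ls X0 k i \<omega> = 1} \<in> events"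
proof (induction k arbitrary: i)
  case 0
  have "X0 i -` {1} \<inter> space P \<in> events"
    using initial_bits_measurable[OF 0] by (rule measurable_sets) simp
  then show ?case
    by (simp add: vimage_def Int_def conj_commute)
next
  case (Suc k)
  have member: "{\<omega> \<in> space P. j \<in> Ls (Suc k) i \<omega>} \<in> events" for j
  proof -
    have Ls: "Ls (Suc k) i \<in> P \<rightarrow>\<^sub>M subset_space"
      using forward_mapping[of "Suc k"] Suc.prems by (auto simp: random_mapping_def)
    have "Ls (Suc k) i -` {A \<in> nonempty_subsets. j \<in> A} \<inter> space P \<in> events"
      using Ls membership_event by (rule measurable_sets)
    moreover have "Ls (Suc k) i \<omega> \<in> nonempty_subsets" if "\<omega> \<in> space P" for \<omega>
      using measurable_space[OF Ls that] by (simp add: space_subset_space)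
    then have "Ls (Suc k) i -` {A \<in> nonempty_subsets. j \<in> A} \<inter> space P
        = {\<omega> \<in> space P. j \<in> Ls (Suc k) i \<omega>}"
      by blast
    ultimately show ?thesis
      by simp
  qed
  have "{\<omega> \<in> space P. \<forall>j\<in>{1..}. j \<in> Ls (Suc k) i \<omega> \<longrightarrow> forward_bits Ls X0 k j \<omega> = 1} \<in> events"
    using Suc.IH member by (intro sets.sets_Collect_countable_All' sets.sets_Collect_imp) auto
  also have "{\<omega> \<in> space P. \<forall>j\<in>{1..}. j \<in> Ls (Suc k) i \<omega> \<longrightarrow> forward_bits Ls X0 k j \<omega> = 1}
      = {\<omega> \<in> space P. forward_bits Ls X0 (Suc k) i \<omega> = 1}"
  proof -
    have "Ls (Suc k) i \<omega> \<subseteq> {1..}" if "\<omega> \<in> space P" for \<omega>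
      using mapping_image_subset(1)[OF forward_mapping, of "Suc k" "{i}" \<omega>] that Suc.prems
      by (auto simp: mapping_image_def)
    then show ?thesis
      using forward_bits_Suc_eq_one_iff[OF Suc.prems] by blast
  qed
  finally show ?case .
qed

lemma forward_bits_measurable:
  assumes "i \<in> {1..}"
  shows "forward_bits Ls X0 k i \<in> P \<rightarrow>\<^sub>M count_space {0, 1}"
proof -
  have "forward_bits Ls X0 k i -` {1} \<inter> space P = {\<omega> \<in> space P. forward_bits Ls X0 k i \<omega> = 1}"
    by auto
  moreover have "forward_bits Ls X0 k i -` {0} \<inter> space P = space P - {\<omega> \<in> space P. forward_bits Ls X0 k i \<omega> = 1}"
    using forward_bits_in[OF assms] by fastforce
  ultimately have "forward_bits Ls X0 k i -` {b} \<inter> space P \<in> events" if "b \<in> {0, 1}" for b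
    using that forward_bits_event[OF assms, of k] by (elim insertE) (simp_all only: sets.compl_sets empty_iff)
  then show ?thesis
    using forward_bits_in[OF assms] by (subst measurable_count_space_eq2) auto
qed

text \<open>The \<open>n\<close>-th moment of \<open>\<Theta>_0\<close> is the probability that
  \<open>n\<close> given bits are 1; as the limit is almost surely \<open>x\<close>, it is also
  \<open>x ^ n\<close>.\<close>

lemma prob_initial_bits:
  assumes x: "AE \<omega> in P. de_finetti_process Ls X0 0 \<omega> = x"
    and S: "finite S" "S \<subseteq> {1..}"
  shows "prob {\<omega> \<in> space P. \<forall>i\<in>S. X0 i \<omega> = 1} = x ^ card S"
proof -
  let ?m = "\<lambda>n. prob {\<omega> \<in> space P. \<forall>i\<in>{1..n}. X0 i \<omega> = 1}"
  have "expectation (\<lambda>\<omega>. de_finetti_process Ls X0 0 \<omega> ^ n) = ?m n" for n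
    unfolding de_finetti_process_def forward_bits.simps
    by (rule expectation_lim_averages_power[of X0 ?m, OF initial_bits_measurable
          exchangeable_prob_all_one[OF forward_exchangeable]])
  moreover have "expectation (\<lambda>\<omega>. de_finetti_process Ls X0 0 \<omega> ^ n) = expectation (\<lambda>_. x ^ n)" for n
  proof (rule integral_cong_AE)
    show "(\<lambda>\<omega>. de_finetti_process Ls X0 0 \<omega> ^ n) \<in> borel_measurable P"
      unfolding de_finetti_process_def forward_bits.simps
      by (intro borel_measurable_power lim_averages_measurable[of X0 ?m, OF initial_bits_measurable
            exchangeable_prob_all_one[OF forward_exchangeable]])
  qed (use x in auto)
  ultimately show ?thesis
    using exchangeable_prob_all_one[OF forward_exchangeable S] by (simp add: prob_space)
qed

lemma forward_mapping_event:
  assumes "i \<in> {1..}" "B \<in> sets mapping_space"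
  shows "{\<omega> \<in> space P. mapping_sequence (Ls i) \<omega> \<in> B} \<in> events"
proof -
  have "mapping_sequence (Ls i) -` B \<inter> space P \<in> events"
    using mapping_sequence_measurable[OF forward_mapping[OF assms(1)]] assms(2) by (rule measurable_sets)
  then show ?thesis
    by (simp add: vimage_def Int_def conj_commute)
qed

lemma prob_mapping_sequence_finite_family:
  assumes J: "finite J" "J \<subseteq> {1..}" and B: "\<And>i. i \<in> J \<Longrightarrow> B i \<in> sets mapping_space"
  shows "prob {\<omega> \<in> space P. \<forall>i\<in>J. mapping_sequence (Ls i) \<omega> \<in> B i}
    = (\<Prod>i\<in>J. prob {\<omega> \<in> space P. mapping_sequence (Ls i) \<omega> \<in> B i})"
\<comment> \<open>\<open>indep_varsD\<close> asks for a non-empty index set; for empty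
  \<open>J\<close> both sides are 1.\<close>
proof (cases "J = {}")
  case False
  have eq: "mapping_sequence (Ls i) -` B i \<inter> space P = {\<omega> \<in> space P. mapping_sequence (Ls i) \<omega> \<in> B i}" for i
    by auto
  have "prob (\<Inter>i\<in>J. mapping_sequence (Ls i) -` B i \<inter> space P)
      = (\<Prod>i\<in>J. prob (mapping_sequence (Ls i) -` B i \<inter> space P))"
    using forward_mapping_indep False J B by (rule indep_varsD)
  moreover have "(\<Inter>i\<in>J. mapping_sequence (Ls i) -` B i \<inter> space P)
      = {\<omega> \<in> space P. \<forall>i\<in>J. mapping_sequence (Ls i) \<omega> \<in> B i}"
    using False by auto
  ultimately show ?thesis
    by (simp only: eq)
qed (simp add: prob_space)

text \<open>The constraints on the mappings form a cylinder \<open>?C\<close> over the whole family,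
  so independence of \<open>X0\<close> from that family splits off the first factor and independence
  of the copies yields the product. This is the base case of the induction over generations.\<close>

lemma prob_initial_bits_and_mappings:
  assumes S: "finite S" "S \<subseteq> {1..}" and J: "finite J" "J \<subseteq> {1..}"
    and B: "\<And>i. i \<in> J \<Longrightarrow> B i \<in> sets mapping_space"
  shows "prob {\<omega> \<in> space P. (\<forall>i\<in>S. X0 i \<omega> = 1) \<and> (\<forall>i\<in>J. mapping_sequence (Ls i) \<omega> \<in> B i)}
    = prob {\<omega> \<in> space P. \<forall>i\<in>S. X0 i \<omega> = 1} * (\<Prod>i\<in>J. prob {\<omega> \<in> space P. mapping_sequence (Ls i) \<omega> \<in> B i})"
proof -
  let ?N = "\<Pi>\<^sub>M k\<in>{1..}. mapping_space" and ?F = "\<lambda>\<omega>. \<lambda>k\<in>{1..}. mapping_sequence (Ls k) \<omega>"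
  let ?C = "{F \<in> space ?N. \<forall>i\<in>J. F i \<in> B i}"
  let ?X = "{\<omega> \<in> space P. \<forall>i\<in>S. X0 i \<omega> = 1}"
    and ?Y = "{\<omega> \<in> space P. \<forall>i\<in>J. mapping_sequence (Ls i) \<omega> \<in> B i}"
  have "?X \<in> sets (vimage_algebra (space P) (bit_sequence X0) bit_sequence_space)"
    using in_vimage_algebra[OF all_one_event[OF S], of "bit_sequence X0" "space P"]
      vimage_all_one_event[of X0 P, OF initial_bits_measurable S(2)] by simp
  moreover have "?Y \<in> sets (vimage_algebra (space P) ?F ?N)"
  proof -
    have "{F \<in> space ?N. F i \<in> B i} \<in> sets ?N" if "i \<in> J" for i
    proof -
      have "(\<lambda>F. F i) \<in> ?N \<rightarrow>\<^sub>M mapping_space"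
        using that J(2) by (intro measurable_component_singleton) auto
      then have "(\<lambda>F. F i) -` B i \<inter> space ?N \<in> sets ?N"
        using B[OF that] by (rule measurable_sets)
      then show ?thesis
        by (simp add: vimage_def Int_def conj_commute)
    qed
    then have "?C \<in> sets ?N"
      using J(1) by (intro sets.sets_Collect_finite_All) auto
    then have "?F -` ?C \<inter> space P \<in> sets (vimage_algebra (space P) ?F ?N)"
      by (rule in_vimage_algebra)
    also have "?F -` ?C \<inter> space P = ?Y"
    proof -
      have "?F \<omega> \<in> space ?N" if "\<omega> \<in> space P" for \<omega>
        using mapping_sequence_in_space[OF forward_mapping that] by (simp add: space_PiM)
      moreover have "(\<forall>i\<in>J. ?F \<omega> i \<in> B i) \<longleftrightarrow> (\<forall>i\<in>J. mapping_sequence (Ls i) \<omega> \<in> B i)" for \<omega>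
        using J(2) by (intro ball_cong refl) (auto simp: subset_iff)
      ultimately show ?thesis
        by blast
    qed
    finally show ?thesis .
  qed
  ultimately have "prob (?X \<inter> ?Y) = prob ?X * prob ?Y"
    by (rule indep_setD[OF forward_indep])
  moreover have "?X \<inter> ?Y = {\<omega> \<in> space P. (\<forall>i\<in>S. X0 i \<omega> = 1) \<and> (\<forall>i\<in>J. mapping_sequence (Ls i) \<omega> \<in> B i)}"
    by auto
  ultimately show ?thesis
    using prob_mapping_sequence_finite_family[OF J B] by simp
qed

lemma prob_forward_mapping_image:
  assumes L: "random_mapping M L" and S: "S \<subseteq> {1..}" and k: "k \<in> {1..}"
  shows "prob {\<omega> \<in> space P. mapping_sequence (Ls k) \<omega> \<in> image_event S T}
    = \<P>(\<omega> in M. mapping_image L S \<omega> = T)"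
proof -
  have "prob (mapping_sequence (Ls k) -` image_event S T \<inter> space P)
      = measure M (mapping_sequence L -` image_event S T \<inter> space M)"
    unfolding measure_distr[OF mapping_sequence_measurable[OF forward_mapping[OF k]]
        image_event_measurable[OF S], symmetric]
      measure_distr[OF mapping_sequence_measurable[OF L] image_event_measurable[OF S], symmetric]
      forward_mapping_distr[OF k] ..
  moreover have "mapping_sequence (Ls k) -` image_event S T \<inter> space P
      = {\<omega> \<in> space P. mapping_sequence (Ls k) \<omega> \<in> image_event S T}"
    by auto
  ultimately show ?thesis
    by (simp only: vimage_image_event[OF L S])
qed

section \<open>Induction over the generations\<close>

context
  fixes x :: real
  assumes L: "random_mapping M L" "label_forgetful M L"
    and fin: "\<forall>j\<in>{1..}. AE \<omega> in M. finite (mapping_image L {1..j} \<omega>)"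
    and x: "x \<in> {0..1}" "AE \<omega> in P. de_finetti_process Ls X0 0 \<omega> = x"
begin

text \<open>Carrying along events about the later mappings makes the induction work on finite
  products of probabilities, so that no independence between \<open>\<sigma>\<close>-algebras generated by
  several steps is needed.\<close>

lemma prob_forward_bits_and_later_mappings:
  assumes "finite S" "S \<subseteq> {1..}" "finite J" "J \<subseteq> {k<..}" "\<And>i. i \<in> J \<Longrightarrow> B i \<in> sets mapping_space"
  shows "prob {\<omega> \<in> space P. (\<forall>i\<in>S. forward_bits Ls X0 k i \<omega> = 1)
      \<and> (\<forall>i\<in>J. mapping_sequence (Ls i) \<omega> \<in> B i)}
    = dual_moment (block_transition M L) x k (card S)
      * (\<Prod>i\<in>J. prob {\<omega> \<in> space P. mapping_sequence (Ls i) \<omega> \<in> B i})"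
  using assms
proof (induction k arbitrary: S J B)
  case 0
  have "J \<subseteq> {1..}"
    using 0 by auto
  then show ?case
    using prob_initial_bits_and_mappings[of S J B] prob_initial_bits[OF x(2), of S] 0 by simp
next
  case (Suc k)
  let ?u = "dual_moment (block_transition M L) x"
  let ?p = "\<lambda>T. \<P>(\<omega> in M. mapping_image L S \<omega> = T)"
  let ?D = "{\<omega> \<in> space P. (\<forall>i\<in>S. forward_bits Ls X0 (Suc k) i \<omega> = 1)
      \<and> (\<forall>i\<in>J. mapping_sequence (Ls i) \<omega> \<in> B i)}"
  \<comment> \<open>The splitting is over the value of the image of \<open>S\<close> under the
    latest mapping, enumerated by codes of finite sets.\<close>
  let ?E = "\<lambda>t. {\<omega> \<in> space P. mapping_image (Ls (Suc k)) S \<omega> = set_decode t}"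
  define c where "c = (\<Prod>i\<in>J. prob {\<omega> \<in> space P. mapping_sequence (Ls i) \<omega> \<in> B i})"
  note S = Suc.prems(1,2) and J = Suc.prems(3,4) and B = Suc.prems(5)
  have k: "Suc k \<in> {1..}" "Suc k \<notin> J" and J1: "J \<subseteq> {1..}"
    using J by auto
  note Ls = forward_mapping[OF k(1)]
  have p: "prob {\<omega> \<in> space P. mapping_sequence (Ls (Suc k)) \<omega> \<in> image_event S T} = ?p T" for T
    by (rule prob_forward_mapping_image[OF L(1) S(2) k(1)])
  have E: "{\<omega> \<in> space P. mapping_sequence (Ls (Suc k)) \<omega> \<in> image_event S (set_decode t)} = ?E t" for t
    unfolding vimage_image_event[OF Ls S(2), symmetric] by auto
  have "(\<lambda>t. prob (?D \<inter> ?E t)) sums prob ?D"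
  proof (rule sums_prob_partition)
    show "?D \<in> events"
      using S J(1) J1 B
      by (intro sets.sets_Collect_conj sets.sets_Collect_finite_All forward_bits_event forward_mapping_event) auto
    show "?E t \<in> events" for t
      by (rule mapping_image_event[OF Ls S(2)])
    show "disjoint_family ?E"
      unfolding disjoint_family_on_def by (auto, metis set_decode_inverse)
    \<comment> \<open>Finiteness is assumed for \<open>L\<close> on \<open>M\<close> and is
      transferred to the copy on \<open>P\<close>: the probabilities of the \<open>?E t\<close>
      agree with those for \<open>L\<close>, which sum to 1, so the union of the \<open>?E t\<close>
      has full probability.\<close>
    have "AE \<omega> in P. finite (mapping_image (Ls (Suc k)) S \<omega>)"
    proof -
      have "(\<lambda>t. ?p (set_decode t) * 1) sums (\<integral>\<omega>. 1 \<partial>M)"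
        by (rule sums_prob_mapping_image[OF L fin S, of "\<lambda>_. 1"]) auto
      then have "(\<lambda>t. prob (?E t)) sums 1"
        using prob_space.prob_space[of M] L(1) by (simp add: random_mapping_def p[symmetric] E)
      moreover have "(\<lambda>t. prob (?E t)) sums prob (\<Union>t. ?E t)"
        using \<open>\<And>t. ?E t \<in> events\<close> \<open>disjoint_family ?E\<close> by (intro finite_measure_UNION) auto
      ultimately have "prob (\<Union>t. ?E t) = 1"
        by (rule sums_unique2[symmetric])
      then have "AE \<omega> in P. \<omega> \<in> (\<Union>t. ?E t)"
        by (rule AE_prob_1)
      then show ?thesis
        by eventually_elim auto
    qed
    then show "AE \<omega> in P. \<exists>t. \<omega> \<in> ?E t"
      using AE_space by eventually_elim (auto, metis set_encode_inverse)
  qed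
  moreover have "prob (?D \<inter> ?E t) = ?p (set_decode t) * ?u k (card (set_decode t)) * c" for t
  \<comment> \<open>The induction hypothesis concerns sets of positive labels. A decoded set
    containing 0 is never an image, so in that case both sides vanish.\<close>
  proof (cases "set_decode t \<subseteq> {1..}")
    case True
    \<comment> \<open>Fixing the image turns the new generation into one more constraint on a later
      mapping, at index \<open>Suc k\<close>, and leaves bits of generation \<open>k\<close> on a
      deterministic set. This is exactly the shape of the induction hypothesis.\<close>
    define B' where "B' = B(Suc k := image_event S (set_decode t))"
    have "?D \<inter> ?E t = {\<omega> \<in> space P. (\<forall>i\<in>set_decode t. forward_bits Ls X0 k i \<omega> = 1)
        \<and> (\<forall>i\<in>insert (Suc k) J. mapping_sequence (Ls i) \<omega> \<in> B' i)}"
    proof -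
      have "(\<forall>i\<in>insert (Suc k) J. mapping_sequence (Ls i) \<omega> \<in> B' i)
          \<longleftrightarrow> mapping_image (Ls (Suc k)) S \<omega> = set_decode t \<and> (\<forall>i\<in>J. mapping_sequence (Ls i) \<omega> \<in> B i)"
        if "\<omega> \<in> space P" for \<omega>
        using k(2) E[of t] that by (auto simp: B'_def)
      then have "((\<forall>i\<in>S. forward_bits Ls X0 (Suc k) i \<omega> = 1) \<and> (\<forall>i\<in>J. mapping_sequence (Ls i) \<omega> \<in> B i))
            \<and> mapping_image (Ls (Suc k)) S \<omega> = set_decode t
          \<longleftrightarrow> (\<forall>i\<in>set_decode t. forward_bits Ls X0 k i \<omega> = 1)
            \<and> (\<forall>i\<in>insert (Suc k) J. mapping_sequence (Ls i) \<omega> \<in> B' i)"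
        if "\<omega> \<in> space P" for \<omega>
        using that forward_bits_Suc_all_one_iff[OF S(2) that] by metis
      then show ?thesis
        by blast
    qed
    also have "prob \<dots> = ?u k (card (set_decode t))
        * (\<Prod>i\<in>insert (Suc k) J. prob {\<omega> \<in> space P. mapping_sequence (Ls i) \<omega> \<in> B' i})"
      using True J B image_event_measurable[OF S(2)] by (intro Suc.IH) (auto simp: B'_def)
    also have "(\<Prod>i\<in>insert (Suc k) J. prob {\<omega> \<in> space P. mapping_sequence (Ls i) \<omega> \<in> B' i})
        = ?p (set_decode t) * c"
    proof -
      have "(\<Prod>i\<in>J. prob {\<omega> \<in> space P. mapping_sequence (Ls i) \<omega> \<in> B' i}) = c"
        unfolding c_def using k(2) by (intro prod.cong refl) (auto simp: B'_def)
      then show ?thesis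
        using J(1) k(2) p by (simp add: B'_def)
    qed
    finally show ?thesis
      by simp
  next
    case False
    then have "?E t = {}" "{\<omega> \<in> space M. mapping_image L S \<omega> = set_decode t} = {}"
      using mapping_image_subset(1)[OF Ls S(2)] mapping_image_subset(1)[OF L(1) S(2)] by blast+
    then show ?thesis
      by (simp only: Int_empty_right measure_empty mult_zero_left)
  qed
  moreover have "(\<lambda>t. ?p (set_decode t) * ?u k (card (set_decode t)) * c) sums (?u (Suc k) (card S) * c)"
    using sums_dual_moment_Suc(2)[OF L fin x(1) S] by (rule sums_mult2)
  ultimately show ?case
    unfolding c_def by (simp only: sums_unique2)
qed

text \<open>With no constraints on later mappings, the bits of generation \<open>k\<close> satisfy
  the hypothesis of the moment formula, with the dual moments as \<open>m\<close>.\<close>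

lemma expectation_de_finetti_process_power:
  "expectation (\<lambda>\<omega>. de_finetti_process Ls X0 k \<omega> ^ n) = dual_moment (block_transition M L) x k n"
  unfolding de_finetti_process_def
proof (rule expectation_lim_averages_power[OF forward_bits_measurable])
  show "prob {\<omega> \<in> space P. \<forall>i\<in>S. forward_bits Ls X0 k i \<omega> = 1} = dual_moment (block_transition M L) x k (card S)"
    if "finite S" "S \<subseteq> {1..}" for S
    using prob_forward_bits_and_later_mappings[OF that, of "{}"] by simp
qed

end

end

subsection \<open>The backward process\<close>

text \<open>The one-step Markov property for test functions, \<open>h\<close> being the transition
  operator applied to \<open>g\<close>. There are countably many histories up to time
  \<open>k\<close>; on each of them the next state is distributed by the transition from the last
  state, and summing over histories gives the claim.\<close>

lemma block_counting_step:
  assumes A: "block_counting_process M L Q A"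
    and g: "\<And>n. 0 \<le> g n" "\<And>n. g n \<le> (1::real)"
    and h: "\<And>n. 0 \<le> h n" "\<And>n. h n \<le> (1::real)"
    and sums: "\<And>n. (\<lambda>m. block_transition M L n m * g m) sums h n"
    and no_zero: "\<And>n. n \<in> {1..} \<Longrightarrow> block_transition M L n 0 = 0"
  shows "(\<integral>\<omega>. g (A (Suc k) \<omega>) \<partial>Q) = (\<integral>\<omega>. h (A k \<omega>) \<partial>Q)"
proof -
  interpret prob_space Q
    using A by (simp add: block_counting_process_def)
  have A_in: "A i \<omega> \<in> {1..}" if "\<omega> \<in> space Q" for i \<omega>
  proof -
    have "A i \<in> Q \<rightarrow>\<^sub>M count_space {1..}"
      using A by (simp add: block_counting_process_def)
    from measurable_space[OF this that] show ?thesis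
      by simp
  qed
  have [measurable]: "A i \<in> Q \<rightarrow>\<^sub>M count_space UNIV" for i
  proof -
    have "A i \<in> Q \<rightarrow>\<^sub>M count_space {1..}"
      using A by (simp add: block_counting_process_def)
    then show ?thesis
      by (rule measurable_compose) (auto simp only: measurable_count_space_eq1 space_count_space)
  qed
  have history_event: "{\<omega> \<in> space Q. \<forall>i\<le>k. A i \<omega> = a i} \<in> events" for a
    by measurable
  have transition: "prob {\<omega> \<in> space Q. A (Suc k) \<omega> = m \<and> (\<forall>i\<le>k. A i \<omega> = a i)}
      = prob {\<omega> \<in> space Q. \<forall>i\<le>k. A i \<omega> = a i} * block_transition M L (a k) m" for a m
  \<comment> \<open>The Markov property is silent on null histories, but there the joint event is
    null as well.\<close>
  proof (cases "prob {\<omega> \<in> space Q. \<forall>i\<le>k. A i \<omega> = a i} = 0")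
    case True
    have "prob {\<omega> \<in> space Q. A (Suc k) \<omega> = m \<and> (\<forall>i\<le>k. A i \<omega> = a i)}
        \<le> prob {\<omega> \<in> space Q. \<forall>i\<le>k. A i \<omega> = a i}"
      using history_event by (intro finite_measure_mono) blast+
    then have "prob {\<omega> \<in> space Q. A (Suc k) \<omega> = m \<and> (\<forall>i\<le>k. A i \<omega> = a i)} = 0"
      unfolding True by (simp only: measure_le_0_iff)
    with True show ?thesis
      by simp
  next
    case False
    then have pos: "prob {\<omega> \<in> space Q. \<forall>i\<le>k. A i \<omega> = a i} > 0"
      by (simp add: zero_less_measure_iff)
    show ?thesis
    \<comment> \<open>The Markov property covers \<open>m \<ge> 1\<close>, while the series for
      \<open>h\<close> includes \<open>m = 0\<close>. That state is never taken, and a sample point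
      of the history shows \<open>a k \<ge> 1\<close>, so \<open>no_zero\<close> makes the
      right-hand side 0 too.\<close>
    proof (cases "m = 0")
      case True
      have "{\<omega> \<in> space Q. \<forall>i\<le>k. A i \<omega> = a i} \<noteq> {}"
        using False measure_empty[of Q] by metis
      then obtain \<omega> where "\<omega> \<in> space Q" "A k \<omega> = a k"
        by blast
      then have "a k \<in> {1..}"
        using A_in[of \<omega> k] by simp
      then have "block_transition M L (a k) 0 = 0"
        by (rule no_zero)
      moreover have "A (Suc k) \<omega> \<noteq> m" if "\<omega> \<in> space Q" for \<omega>
        using True A_in[OF that, of "Suc k"] by simp
      then have "{\<omega> \<in> space Q. A (Suc k) \<omega> = m \<and> (\<forall>i\<le>k. A i \<omega> = a i)} = {}"
        by blast
      ultimately show ?thesis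
        by (simp only: True measure_empty mult_zero_right)
    next
      case False
      then have "m \<in> {1..}"
        by simp
      with A pos have "cond_prob Q (\<lambda>\<omega>. A (Suc k) \<omega> = m) (\<lambda>\<omega>. \<forall>i\<le>k. A i \<omega> = a i) = block_transition M L (a k) m"
        unfolding block_counting_process_def by blast
      then show ?thesis
        unfolding cond_prob_def nonzero_divide_eq_eq[OF less_imp_neq[OF pos, symmetric]]
        by (rule trans[OF _ mult.commute])
    qed
  qed
  \<comment> \<open>Histories as lists form a countable type, so \<open>to_nat\<close> indexes the
    partition by naturals; a number that codes no history attained yields an empty event.\<close>
  define past where "past \<omega> = map (\<lambda>i. A i \<omega>) [0..<Suc k]" for \<omega>
  define E where "E t = {\<omega> \<in> space Q. to_nat (past \<omega>) = t}" for t
  have past_eq_iff: "past \<omega> = past \<omega>' \<longleftrightarrow> (\<forall>i\<le>k. A i \<omega> = A i \<omega>')" for \<omega> \<omega>'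
    unfolding past_def map_eq_conv by (auto simp: less_Suc_eq_le)
  have E_cases: "E t = {} \<or> (\<exists>a. E t = {\<omega> \<in> space Q. \<forall>i\<le>k. A i \<omega> = a i})" for t
  proof (cases "E t = {}")
    case False
    then obtain \<omega>' where \<omega>': "t = to_nat (past \<omega>')"
      by (auto simp: E_def)
    have "E t = {\<omega> \<in> space Q. \<forall>i\<le>k. A i \<omega> = A i \<omega>'}"
      unfolding E_def \<omega>' by (simp only: to_nat_split inj_eq[OF inj_to_nat] past_eq_iff)
    then show ?thesis
      by (intro disjI2 exI)
  qed simp
  have E_event: "E t \<in> events" for t
    using E_cases[of t] history_event by (elim disjE exE) simp_all
  have E_disjoint: "disjoint_family E"
    by (auto simp: disjoint_family_on_def E_def)
  have g_int: "integrable Q (\<lambda>\<omega>. g (A i \<omega>))" and h_int: "integrable Q (\<lambda>\<omega>. h (A i \<omega>))" for i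
    by (rule integrable_const_bound[where B = 1]; use g h in simp)+
  have same: "expectation (\<lambda>\<omega>. g (A (Suc k) \<omega>) * indicator (E t) \<omega>) = expectation (\<lambda>\<omega>. h (A k \<omega>) * indicator (E t) \<omega>)" for t
  proof (cases "E t = {}")
    case False
    then obtain a where E: "E t = {\<omega> \<in> space Q. \<forall>i\<le>k. A i \<omega> = a i}"
      using E_cases[of t] by blast
    let ?F = "\<lambda>m. {\<omega> \<in> space Q. A (Suc k) \<omega> = m}"
    have "integrable Q (\<lambda>\<omega>. g (A (Suc k) \<omega>) * indicator (E t) \<omega>)"
      using integrable_mult_indicator[OF E_event g_int, of t "Suc k"] by (simp add: mult.commute)
    then have "(\<lambda>m. expectation (\<lambda>\<omega>. g (A (Suc k) \<omega>) * indicator (E t) \<omega> * indicator (?F m) \<omega>))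
        sums expectation (\<lambda>\<omega>. g (A (Suc k) \<omega>) * indicator (E t) \<omega>)"
      by (rule sums_expectation_partition) (auto simp: disjoint_family_on_def)
    moreover have "expectation (\<lambda>\<omega>. g (A (Suc k) \<omega>) * indicator (E t) \<omega> * indicator (?F m) \<omega>)
        = prob (E t) * (block_transition M L (a k) m * g m)" for m
    proof -
      have "g (A (Suc k) \<omega>) * indicator (E t) \<omega> * indicator (?F m) \<omega> = g m * indicator (?F m \<inter> E t) \<omega>" for \<omega>
        by (auto simp: indicator_def)
      then have "expectation (\<lambda>\<omega>. g (A (Suc k) \<omega>) * indicator (E t) \<omega> * indicator (?F m) \<omega>)
          = g m * prob (?F m \<inter> E t)"
        using E_event[of t] by (simp only: integral_mult_right_zero) simp
      also have "?F m \<inter> E t = {\<omega> \<in> space Q. A (Suc k) \<omega> = m \<and> (\<forall>i\<le>k. A i \<omega> = a i)}"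
        by (auto simp: E)
      finally show ?thesis
        by (simp add: transition E)
    qed
    ultimately have "(\<lambda>m. prob (E t) * (block_transition M L (a k) m * g m))
        sums expectation (\<lambda>\<omega>. g (A (Suc k) \<omega>) * indicator (E t) \<omega>)"
      by simp
    moreover have "(\<lambda>m. prob (E t) * (block_transition M L (a k) m * g m)) sums (prob (E t) * h (a k))"
      using sums by (rule sums_mult)
    moreover have "expectation (\<lambda>\<omega>. h (A k \<omega>) * indicator (E t) \<omega>) = prob (E t) * h (a k)"
    proof -
      have "h (A k \<omega>) * indicator (E t) \<omega> = h (a k) * indicator (E t) \<omega>" for \<omega>
        by (auto simp: indicator_def E)
      then show ?thesis
        using E_event[of t] by (simp only: integral_mult_right_zero) simp
    qed
    ultimately show ?thesis
      by (simp only: sums_unique2)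
  qed simp
  have cover: "AE \<omega> in Q. \<exists>t. \<omega> \<in> E t"
    by (simp add: E_def)
  have "(\<lambda>t. expectation (\<lambda>\<omega>. g (A (Suc k) \<omega>) * indicator (E t) \<omega>)) sums expectation (\<lambda>\<omega>. g (A (Suc k) \<omega>))"
    by (rule sums_expectation_partition[OF g_int E_event E_disjoint cover])
  moreover have "(\<lambda>t. expectation (\<lambda>\<omega>. h (A k \<omega>) * indicator (E t) \<omega>)) sums expectation (\<lambda>\<omega>. h (A k \<omega>))"
    by (rule sums_expectation_partition[OF h_int E_event E_disjoint cover])
  ultimately show ?thesis
    unfolding same by (rule sums_unique2)
qed

lemma block_transition_zero:
  assumes "random_mapping M L" "n \<in> {1..}"
  shows "block_transition M L n 0 = 0"
proof -
  have "mapping_image L {1..n} \<omega> \<noteq> {}" if "\<omega> \<in> space M" for \<omega>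
    using mapping_image_subset(2)[OF assms(1) _ that, of "{1..n}"] assms(2) by auto
  then have "{\<omega> \<in> space M. ecard (mapping_image L {1..n} \<omega>) = enat 0} = {}"
    by (auto simp: ecard_def)
  then show ?thesis
    by (simp only: block_transition_def measure_empty)
qed

text \<open>Each Markov step moves one unit of time from the chain into the index of the dual
  moment. Keeping \<open>i\<close> arbitrary lets the induction on \<open>k\<close> repeat this
  until the chain is back at time 0.\<close>

lemma expectation_block_counting:
  assumes L: "random_mapping M L" "label_forgetful M L"
    and fin: "\<forall>j\<in>{1..}. AE \<omega> in M. finite (mapping_image L {1..j} \<omega>)"
    and A: "block_counting_process M L Q A" and x: "x \<in> {0..1}"
  shows "(\<integral>\<omega>. dual_moment (block_transition M L) x i (A k \<omega>) \<partial>Q)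
    = (\<integral>\<omega>. dual_moment (block_transition M L) x (i + k) (A 0 \<omega>) \<partial>Q)"
proof (induction k arbitrary: i)
  case (Suc k)
  let ?u = "dual_moment (block_transition M L) x"
  have "(\<lambda>m. block_transition M L n m * ?u i m) sums ?u (Suc i) n" for n
    using sums_dual_moment_Suc(1)[OF L fin x, of "{1..n}" i] by fastforce
  then have "(\<integral>\<omega>. ?u i (A (Suc k) \<omega>) \<partial>Q) = (\<integral>\<omega>. ?u (Suc i) (A k \<omega>) \<partial>Q)"
    using dual_moment_bounds[OF L fin x] block_transition_zero[OF L(1)]
    by (intro block_counting_step[OF A]) blast+
  then show ?case
    using Suc[of "Suc i"] by simp
qed simp

subsection \<open>Duality\<close>

theorem theorem2p5:
  fixes M :: "'a measure" and L :: "nat \<Rightarrow> 'a \<Rightarrow> nat set"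
    and P :: "'b measure" and Ls :: "nat \<Rightarrow> nat \<Rightarrow> 'b \<Rightarrow> nat set" and X0 :: "nat \<Rightarrow> 'b \<Rightarrow> nat"
    and Q :: "'c measure" and A :: "nat \<Rightarrow> 'c \<Rightarrow> nat"
    and k n :: nat and x :: real
  assumes "random_mapping M L"
    and "label_forgetful M L"
    and "\<And>j. j \<in> {1..} \<Longrightarrow> AE \<omega> in M. finite (mapping_image L {1..j} \<omega>)"
    and "forward_input M L P Ls X0"
    and "block_counting_process M L Q A"
    and "k \<in> {1..}" and "n \<in> {1..}" and "x \<in> {0..1}"
    and "AE \<omega> in P. de_finetti_process Ls X0 0 \<omega> = x"
    and "AE \<omega> in Q. A 0 \<omega> = n"
  shows "prob_space.expectation P (\<lambda>\<omega>. de_finetti_process Ls X0 k \<omega> ^ n)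
       = prob_space.expectation Q (\<lambda>\<omega>. x ^ A k \<omega>)"
proof -
  interpret Q: prob_space Q
    using assms(5) by (simp add: block_counting_process_def)
  have fin: "\<forall>j\<in>{1..}. AE \<omega> in M. finite (mapping_image L {1..j} \<omega>)"
    using assms(3) by blast
  let ?u = "dual_moment (block_transition M L) x"
  \<comment> \<open>At \<open>i = 0\<close> the dual moment is the plain power, so all
    \<open>k\<close> steps move into the index.\<close>
  have "(\<integral>\<omega>. x ^ A k \<omega> \<partial>Q) = (\<integral>\<omega>. ?u k (A 0 \<omega>) \<partial>Q)"
    using expectation_block_counting[OF assms(1,2) fin assms(5,8), of 0 k] by simp
  also have "\<dots> = (\<integral>\<omega>. ?u k n \<partial>Q)"
  proof (rule integral_cong_AE)
    have "A 0 \<in> Q \<rightarrow>\<^sub>M count_space {1..}"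
      using assms(5) by (simp add: block_counting_process_def)
    then show "(\<lambda>\<omega>. ?u k (A 0 \<omega>)) \<in> borel_measurable Q"
      by (rule measurable_compose) (simp only: measurable_count_space_eq1 space_borel Pi_UNIV UNIV_I)
    show "AE \<omega> in Q. ?u k (A 0 \<omega>) = ?u k n"
      using assms(10) by eventually_elim simp
  qed simp
  also have "\<dots> = (\<integral>\<omega>. de_finetti_process Ls X0 k \<omega> ^ n \<partial>P)"
    using expectation_de_finetti_process_power[OF assms(4,1,2) fin assms(8,9), of k n]
    by (simp add: Q.prob_space)
  finally show ?thesis
    by (rule sym)
qed

end
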